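(* Let $\Omega\subsetneq\mathbb{C}$ be a domain, let $K_\Omega(z)$ denote its Bergman kernel on the diagonal and $\delta_\Omega(z)=\operatorname{dist}(z,\partial\Omega)$. All inequalities below are assumed to hold for all $z\in\Omega$ with $\delta_\Omega(z)$ sufficiently small (i.e. as $z\to\partial\Omega$). (1) If $\Omega$ is bounded and there is a constant $c>0$ with $K_\Omega(z)\ge c\,\delta_\Omega(z)^{-2}$ as $z\to\partial\Omega$, then $\partial\Omega$ is uniformly perfect. (2) If there is a constant $M>0$ with $K_\Omega(z)\ge \dfrac{M}{\delta_\Omega(z)^2\log\frac{1}{\delta_\Omega(z)}}$ as $z\to\partial\Omega$, then there exists $\alpha>1$ such that $\partial\Omega$ satisfies condition $(U)_{1,\alpha}$. If moreover $M>\frac{1}{2\pi}$, then $\alpha$ can be chosen in $(1,2)$. (3) If there is a constant $c>0$ with $K_\Omega(z)\ge \dfrac{c}{\delta_\Omega(z)^2\log\log\frac{1}{\delta_\Omega(z)}}$ as $z\to\partial\Omega$, then there exists $\beta>0$ such that $\partial\Omega$ satisfies condition $(U)_{2,\beta}$.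
   Context: The Bergman kernel $K_\Omega(z)=K_\Omega(z,z)$ is the reproducing kernel on the diagonal of the Bergman space $A^2(\Omega)$ of holomorphic functions on $\Omega$ that are square integrable with respect to Lebesgue measure. A closed set $K\subset\mathbb{C}$ is uniformly perfect if there is a constant $C\in(0,1)$ such that $\{z\in\mathbb{C}: Cr\le|z-a|\le r\}\cap K\neq\emptyset$ for every $a\in K$ and every $r\in(0,\operatorname{diam}(K))$. For an increasing function $h$ on $[0,r_0)$ with $h(r)\le r$, a closed set $K\subset\mathbb{C}$ is $h$-uniformly perfect if $\{z\in\mathbb{C}: h(r)\le|z-a|\le r\}\cap K\neq\emptyset$ for every $a\in K$ and every $r\in(0,r_0)$. Let $h_{1,\alpha}(r)=r^\alpha$ ($\alpha>1$) and $h_{2,\beta}(r)=r(-\log r)^{-\beta}$ ($\beta>0$). A closed set satisfies condition $(U)_{1,\alpha}$ (resp. $(U)_{2,\beta}$) if there exist constants $C>0$ and $r_0>0$ such that it is $Ch_{1,\alpha}$-uniformly perfect (resp. $Ch_{2,\beta}$-uniformly perfect) with that $r_0$. *)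

theory Defs
  imports "HOL-Complex_Analysis.Complex_Analysis"
begin

definition bergman_space :: "complex set \<Rightarrow> (complex \<Rightarrow> complex) set" where
  "bergman_space \<Omega> = {f. f holomorphic_on \<Omega> \<and>
      set_integrable lborel \<Omega> (\<lambda>\<zeta>. (cmod (f \<zeta>))\<^sup>2)}"

definition bergman_kernel2 :: "complex set \<Rightarrow> complex \<Rightarrow> complex \<Rightarrow> complex" where
  "bergman_kernel2 \<Omega> \<zeta> w =
     (THE k. k \<in> bergman_space \<Omega> \<and> (\<forall>z. z \<notin> \<Omega> \<longrightarrow> k z = 0) \<and>
        (\<forall>f\<in>bergman_space \<Omega>. f w = (LINT \<xi>:\<Omega>|lborel. f \<xi> * cnj (k \<xi>)))) \<zeta>"

definition bergman_kernel :: "complex set \<Rightarrow> complex \<Rightarrow> real" where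
  "bergman_kernel \<Omega> z = Re (bergman_kernel2 \<Omega> z z)"

definition boundary_dist :: "complex set \<Rightarrow> complex \<Rightarrow> real" where
  "boundary_dist \<Omega> z = infdist z (frontier \<Omega>)"

definition uniformly_perfect :: "complex set \<Rightarrow> bool" where
  "uniformly_perfect K \<longleftrightarrow> closed K \<and>
     (\<exists>C. 0 < C \<and> C < 1 \<and> (\<forall>a\<in>K. \<forall>r. 0 < r \<and> r < diameter K \<longrightarrow>
        (\<exists>z\<in>K. C * r \<le> cmod (z - a) \<and> cmod (z - a) \<le> r)))"

definition h_uniformly_perfect :: "(real \<Rightarrow> real) \<Rightarrow> real \<Rightarrow> complex set \<Rightarrow> bool" where
  "h_uniformly_perfect h r0 K \<longleftrightarrow> closed K \<and> 0 < r0 \<and>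
     mono_on {0..<r0} h \<and> (\<forall>r\<in>{0..<r0}. h r \<le> r) \<and>
     (\<forall>a\<in>K. \<forall>r. 0 < r \<and> r < r0 \<longrightarrow>
        (\<exists>z\<in>K. h r \<le> cmod (z - a) \<and> cmod (z - a) \<le> r))"

definition h1 :: "real \<Rightarrow> real \<Rightarrow> real" where
  "h1 \<alpha> r = r powr \<alpha>"

definition h2 :: "real \<Rightarrow> real \<Rightarrow> real" where
  "h2 \<beta> r = r * (- ln r) powr (- \<beta>)"

definition condU1 :: "real \<Rightarrow> complex set \<Rightarrow> bool" where
  "condU1 \<alpha> K \<longleftrightarrow> (\<exists>C r0. C > 0 \<and> r0 > 0 \<and> h_uniformly_perfect (\<lambda>r. C * h1 \<alpha> r) r0 K)"

definition condU2 :: "real \<Rightarrow> complex set \<Rightarrow> bool" where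
  "condU2 \<beta> K \<longleftrightarrow> (\<exists>C r0. C > 0 \<and> r0 > 0 \<and> h_uniformly_perfect (\<lambda>r. C * h2 \<beta> r) r0 K)"

end

theory Submission
  imports Defs "HOL-Real_Asymp.Real_Asymp"
begin

text \<open>Suppose \<open>\<partial>\<Omega>\<close> misses the annulus \<open>s \<le> |z - a| \<le> r\<close> around some \<open>a \<in> \<partial>\<Omega>\<close>. If \<open>s\<close> is small compared with
  the inradius of \<open>\<Omega>\<close>, the annulus lies in \<open>\<Omega>\<close>. For \<open>f\<close> in the Bergman space and \<open>|z - a| = \<rho>\<close> the term
  \<open>c / (z - a)\<close> dominates the Laurent expansion of \<open>f\<close>: integrating the mean value inequality over all
  circles of the annulus gives \<open>|c|\<^sup>2 \<le> \<parallel>f\<parallel>\<^sup>2 / (2\<pi> log (r/s))\<close>, while the remaining terms contribute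
  \<open>O(\<rho>/r + s/\<rho>) \<parallel>f\<parallel>\<close> to \<open>\<rho> |f z|\<close>. Hence
  \<open>K(z) \<rho>\<^sup>2 \<le> ((2\<pi> log (r/s))\<^sup>-\<^sup>1\<^sup>/\<^sup>2 + O(\<rho>/r + s/\<rho>))\<^sup>2\<close>. Since \<open>dist(z, \<partial>\<Omega>) \<le> \<rho>\<close>, the assumed lower bounds on
  the kernel are violated for \<open>s = C r\<close>, \<open>s = r\<^sup>\<alpha>\<close> and \<open>s = r (- log r)\<^sup>-\<^sup>\<beta>\<close> respectively, with
  \<open>\<rho>/r = C\<^sup>1\<^sup>/\<^sup>2\<close>, \<open>1 / log (1/r)\<close> and \<open>1 / log log (1/r)\<close>; in the second case the leading constant
  \<open>1 / (2\<pi> (\<alpha> - 1))\<close> is what has to be compared with \<open>M\<close>.\<close>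

section \<open>Rotation invariance of planar Lebesgue measure\<close>

text \<open>The push-forward of the product measure under \<open>Complex\<close> agrees with
  \<open>lborel\<close> on boxes, and \<open>lborel_eqI\<close> says that boxes determine the
  measure; the rest is Tonelli.\<close>

lemma nn_integral_lborel_complex:
  fixes F :: "complex \<Rightarrow> ennreal"
  assumes [measurable]: "F \<in> borel_measurable borel"
  shows "(\<integral>\<^sup>+z. F z \<partial>lborel) = (\<integral>\<^sup>+x. \<integral>\<^sup>+y. F (Complex x y) \<partial>lborel \<partial>lborel)"
proof -
  have meas[measurable]: "(\<lambda>(x, y). Complex x y) \<in> borel \<rightarrow>\<^sub>M borel"
    by (intro borel_measurable_continuous_onI) (auto simp: case_prod_unfold intro!: continuous_intros)
  have meas': "(\<lambda>(x, y). Complex x y) \<in> lborel \<Otimes>\<^sub>M lborel \<rightarrow>\<^sub>M borel"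
    using meas by (simp add: measurable_lborel1 borel_prod[symmetric] cong: measurable_cong_sets)
  have eq: "lborel = distr (lborel \<Otimes>\<^sub>M lborel) borel (\<lambda>(x, y). Complex x y)"
  proof (rule lborel_eqI)
    fix l u :: complex
    assume lu: "\<And>b. b \<in> Basis \<Longrightarrow> l \<bullet> b \<le> u \<bullet> b"
    then have lu': "Re l \<le> Re u" "Im l \<le> Im u"
      using lu[of 1] lu[of \<i>] by (auto simp: Basis_complex_def inner_complex_def)
    have "(\<lambda>(x, y). Complex x y) -` box l u \<inter> space (lborel \<Otimes>\<^sub>M lborel)
        = box (Re l) (Re u) \<times> box (Im l) (Im u)"
      by (auto simp: box_def Basis_complex_def inner_complex_def space_pair_measure)
    then have "emeasure (distr (lborel \<Otimes>\<^sub>M lborel) borel (\<lambda>(x, y). Complex x y)) (box l u)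
        = emeasure (lborel \<Otimes>\<^sub>M lborel) (box (Re l) (Re u) \<times> box (Im l) (Im u))"
      by (subst emeasure_distr[OF meas']) auto
    also have "\<dots> = ennreal (Re u - Re l) * ennreal (Im u - Im l)"
      using lu' by (subst lborel.emeasure_pair_measure_Times) (auto simp: box_real)
    also have "\<dots> = (\<Prod>b\<in>Basis. (u - l) \<bullet> b)"
      using lu' by (simp add: Basis_complex_def inner_complex_def ennreal_mult')
    finally show "emeasure (distr (lborel \<Otimes>\<^sub>M lborel) borel (\<lambda>(x, y). Complex x y)) (box l u)
        = (\<Prod>b\<in>Basis. (u - l) \<bullet> b)" .
  qed simp
  have "(\<integral>\<^sup>+z. F z \<partial>lborel) = (\<integral>\<^sup>+z. F z \<partial>distr (lborel \<Otimes>\<^sub>M lborel) borel (\<lambda>(x, y). Complex x y))"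
    using eq by simp
  also have "\<dots> = (\<integral>\<^sup>+p. F (Complex (fst p) (snd p)) \<partial>(lborel \<Otimes>\<^sub>M lborel))"
    by (subst nn_integral_distr[OF meas']) (auto simp: case_prod_unfold)
  also have "\<dots> = (\<integral>\<^sup>+x. \<integral>\<^sup>+y. F (Complex x y) \<partial>lborel \<partial>lborel)"
    using meas' by (subst lborel.nn_integral_fst[symmetric])
      (auto intro!: measurable_compose[OF _ assms] simp: case_prod_unfold)
  finally show ?thesis .
qed

lemma nn_integral_lborel_plus:
  fixes F :: "real \<Rightarrow> ennreal"
  assumes "F \<in> borel_measurable borel"
  shows "(\<integral>\<^sup>+x. F (x + t) \<partial>lborel) = (\<integral>\<^sup>+x. F x \<partial>lborel)"
  using nn_integral_real_affine[OF assms, of 1 t] by (simp add: add.commute)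

text \<open>For fixed real part \<open>x\<close> the shear is a translation by \<open>a * x\<close>
  in the inner variable.\<close>

lemma nn_integral_shear_y:
  fixes F :: "complex \<Rightarrow> ennreal"
  assumes [measurable]: "F \<in> borel_measurable borel"
  shows "(\<integral>\<^sup>+z. F (Complex (Re z) (Im z + a * Re z)) \<partial>lborel) = (\<integral>\<^sup>+z. F z \<partial>lborel)"
proof -
  have [measurable]: "(\<lambda>z. Complex (Re z) (Im z + a * Re z)) \<in> borel \<rightarrow>\<^sub>M borel"
    by (intro borel_measurable_continuous_onI continuous_intros)
  have m: "(\<lambda>y. F (Complex x y)) \<in> borel_measurable borel" for x
    by (intro measurable_compose[OF _ assms] borel_measurable_continuous_onI continuous_intros)
  show ?thesis
    by (simp add: nn_integral_lborel_complex nn_integral_lborel_plus[OF m])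
qed

text \<open>The same argument for horizontal shears, after Tonelli has made the real part the inner
  variable.\<close>

lemma nn_integral_shear_x:
  fixes F :: "complex \<Rightarrow> ennreal"
  assumes [measurable]: "F \<in> borel_measurable borel"
  shows "(\<integral>\<^sup>+z. F (Complex (Re z + a * Im z) (Im z)) \<partial>lborel) = (\<integral>\<^sup>+z. F z \<partial>lborel)"
proof -
  have [measurable]: "(\<lambda>z. Complex (Re z + a * Im z) (Im z)) \<in> borel \<rightarrow>\<^sub>M borel"
    by (intro borel_measurable_continuous_onI continuous_intros)
  have m: "(\<lambda>x. F (Complex x y)) \<in> borel_measurable borel" for y
    by (intro measurable_compose[OF _ assms] borel_measurable_continuous_onI continuous_intros)
  have swap: "(\<integral>\<^sup>+x. \<integral>\<^sup>+y. G (Complex x y) \<partial>lborel \<partial>lborel) = (\<integral>\<^sup>+y. \<integral>\<^sup>+x. G (Complex x y) \<partial>lborel \<partial>lborel)"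
    if G: "G \<in> borel_measurable borel" for G :: "complex \<Rightarrow> ennreal"
  proof (rule lborel_pair.Fubini'[symmetric])
    have "(\<lambda>(x, y). Complex x y) \<in> borel \<rightarrow>\<^sub>M borel"
      by (intro borel_measurable_continuous_onI) (auto simp: case_prod_unfold intro!: continuous_intros)
    then have "(\<lambda>p. G (case p of (x, y) \<Rightarrow> Complex x y)) \<in> borel_measurable borel"
      using G by (rule measurable_compose)
    then show "(\<lambda>(x, y). G (Complex x y)) \<in> borel_measurable (lborel \<Otimes>\<^sub>M lborel)"
      by (simp add: lborel_prod case_prod_unfold)
  qed
  have "(\<integral>\<^sup>+z. F (Complex (Re z + a * Im z) (Im z)) \<partial>lborel)
      = (\<integral>\<^sup>+y. \<integral>\<^sup>+x. F (Complex (x + a * y) y) \<partial>lborel \<partial>lborel)"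
    by (subst nn_integral_lborel_complex, measurable, subst swap) simp_all
  also have "\<dots> = (\<integral>\<^sup>+y. \<integral>\<^sup>+x. F (Complex x y) \<partial>lborel \<partial>lborel)"
    by (simp add: nn_integral_lborel_plus[OF m])
  also have "\<dots> = (\<integral>\<^sup>+z. F z \<partial>lborel)"
    by (simp add: nn_integral_lborel_complex swap)
  finally show ?thesis .
qed

text \<open>A rotation by an angle other than \<open>\<pi>\<close> is a product of three shears.\<close>

lemma nn_integral_rotation_aux:
  fixes F :: "complex \<Rightarrow> ennreal"
  assumes [measurable]: "F \<in> borel_measurable borel" and v: "cmod v = 1" "Re v \<noteq> -1"
  shows "(\<integral>\<^sup>+z. F (v * z) \<partial>lborel) = (\<integral>\<^sup>+z. F z \<partial>lborel)"
proof -
  \<comment> \<open>If \<open>v\<close> has argument \<open>\<theta>\<close>, then \<open>a\<close>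
    is \<open>- tan (\<theta> / 2)\<close>. The outer shears \<open>X\<close> have slope
    \<open>a\<close>, the middle shear \<open>Y\<close> has slope \<open>sin \<theta>\<close>;
    \<open>Re v \<noteq> -1\<close> keeps the denominator away from 0.\<close>
  define a where "a = - Im v / (1 + Re v)"
  define X where "X z = Complex (Re z + a * Im z) (Im z)" for z
  define Y where "Y z = Complex (Re z) (Im z + Im v * Re z)" for z
  have [measurable]: "X \<in> borel \<rightarrow>\<^sub>M borel" "Y \<in> borel \<rightarrow>\<^sub>M borel"
    unfolding X_def Y_def by (intro borel_measurable_continuous_onI continuous_intros)+
  have n: "(Re v)\<^sup>2 + (Im v)\<^sup>2 = 1"
    using v by (simp add: cmod_def)
  have d: "1 + Re v \<noteq> 0" using v by linarith
  have e1: "1 + a * Im v = Re v"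
    using n d by (simp add: a_def field_simps power2_eq_square)
  have e2: "a + a * Re v = - Im v"
  proof -
    have "a * (1 + Re v) = - Im v"
      using d by (simp add: a_def)
    then show ?thesis by (simp add: algebra_simps)
  qed
  have "X (Y (X z)) = v * z" for z
  proof -
    have 1: "Im z + Im v * (Re z + a * Im z) = Im (v * z)"
      using e1 by (simp add: algebra_simps flip: e1)
    have "Re z + a * Im z + a * Im (v * z) = Re z * (1 + a * Im v) + Im z * (a + a * Re v)"
      by (simp add: algebra_simps)
    also have "\<dots> = Re (v * z)"
      by (simp add: e1 e2)
    finally show ?thesis
      using 1 by (auto simp: X_def Y_def complex_eq_iff)
  qed
  then have "(\<integral>\<^sup>+z. F (v * z) \<partial>lborel) = (\<integral>\<^sup>+z. (\<lambda>z. F (X (Y z))) (X z) \<partial>lborel)"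
    by simp
  also have "\<dots> = (\<integral>\<^sup>+z. (\<lambda>z. F (X z)) (Y z) \<partial>lborel)"
    by (subst (2) X_def) (rule nn_integral_shear_x, measurable)
  also have "\<dots> = (\<integral>\<^sup>+z. F (X z) \<partial>lborel)"
    by (subst Y_def) (rule nn_integral_shear_y, measurable)
  also have "\<dots> = (\<integral>\<^sup>+z. F z \<partial>lborel)"
    by (subst X_def) (rule nn_integral_shear_x, measurable)
  finally show ?thesis .
qed

lemma nn_integral_rotation:
  fixes F :: "complex \<Rightarrow> ennreal"
  assumes [measurable]: "F \<in> borel_measurable borel" and "cmod u = 1"
  shows "(\<integral>\<^sup>+z. F (u * z) \<partial>lborel) = (\<integral>\<^sup>+z. F z \<partial>lborel)"
proof -
  \<comment> \<open>Rotating twice by the principal square root also covers the angle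
    \<open>pi\<close>: its real part is nonnegative, hence never -1.\<close>
  define v where "v = csqrt u"
  have "0 \<le> Re v"
    using csqrt_principal[of u] unfolding v_def by linarith
  moreover have "v * v = u" "cmod v = 1"
    using assms by (simp_all add: v_def norm_csqrt flip: power2_eq_square)
  ultimately have v: "v * v = u" "cmod v = 1" "Re v \<noteq> -1"
    by auto
  have "(\<integral>\<^sup>+z. F (u * z) \<partial>lborel) = (\<integral>\<^sup>+z. (\<lambda>z. F (v * z)) (v * z) \<partial>lborel)"
    by (simp add: v(1) flip: mult.assoc)
  also have "\<dots> = (\<integral>\<^sup>+z. F (v * z) \<partial>lborel)"
    by (rule nn_integral_rotation_aux) (use v in auto)
  also have "\<dots> = (\<integral>\<^sup>+z. F z \<partial>lborel)"
    by (rule nn_integral_rotation_aux) (use v in auto)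
  finally show ?thesis .
qed

text \<open>Rotation about \<open>a\<close> preserves the integral for each angle; averaging over
  the angle and exchanging the integrals gives the claim. This takes the place of polar coordinates
  throughout.\<close>

lemma nn_integral_circle_average:
  fixes F :: "complex \<Rightarrow> ennreal"
  assumes [measurable]: "F \<in> borel_measurable borel"
  shows "(\<integral>\<^sup>+z. F z \<partial>lborel)
    = (\<integral>\<^sup>+z. (\<integral>\<^sup>+x\<in>{0..1}. F (a + exp (2 * of_real pi * \<i> * of_real x) * (z - a)) \<partial>lborel) \<partial>lborel)"
proof -
  let ?e = "\<lambda>x::real. exp (2 * of_real pi * \<i> * of_real x) :: complex"
  have tr: "(\<integral>\<^sup>+z. G (z - b) \<partial>lborel) = (\<integral>\<^sup>+z. G z \<partial>lborel)"
    if [measurable]: "G \<in> borel_measurable borel" for G :: "complex \<Rightarrow> ennreal" and b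
    by (subst (2) lborel_distr_plus[of "-b", symmetric]) (simp add: nn_integral_distr)
  have inv: "(\<integral>\<^sup>+z. F (a + ?e x * (z - a)) \<partial>lborel) = (\<integral>\<^sup>+z. F z \<partial>lborel)" for x
  proof -
    have "(\<integral>\<^sup>+z. F (a + ?e x * (z - a)) \<partial>lborel) = (\<integral>\<^sup>+z. F (a + ?e x * z) \<partial>lborel)"
      by (rule tr[where G = "\<lambda>z. F (a + ?e x * z)"]) measurable
    also have "\<dots> = (\<integral>\<^sup>+z. F (a + z) \<partial>lborel)"
      by (rule nn_integral_rotation[where F = "\<lambda>z. F (a + z)"]) (auto simp: norm_exp_eq_Re)
    also have "\<dots> = (\<integral>\<^sup>+z. F z \<partial>lborel)"
      using tr[of F "-a"] by (simp add: add.commute)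
    finally show ?thesis .
  qed
  have cont: "continuous_on UNIV (\<lambda>p::complex \<times> real. a + ?e (snd p) * (fst p - a))"
    by (intro continuous_intros)
  have m: "(\<lambda>(z, x). F (a + ?e x * (z - a)) * indicator {0..1} x)
      \<in> borel_measurable (lborel \<Otimes>\<^sub>M lborel)"
  proof -
    have [measurable]: "(\<lambda>p. F (a + ?e (snd p) * (fst p - a))) \<in> borel_measurable (lborel \<Otimes>\<^sub>M lborel)"
      unfolding lborel_prod using borel_measurable_continuous_onI[OF cont]
      by (intro measurable_compose[OF _ assms]) auto
    show ?thesis unfolding case_prod_unfold by measurable
  qed
  have "(\<integral>\<^sup>+z. (\<integral>\<^sup>+x\<in>{0..1}. F (a + ?e x * (z - a)) \<partial>lborel) \<partial>lborel)
      = (\<integral>\<^sup>+x. \<integral>\<^sup>+z. F (a + ?e x * (z - a)) * indicator {0..1} x \<partial>lborel \<partial>lborel)"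
    using m by (rule lborel_pair.Fubini'[symmetric])
  also have "\<dots> = (\<integral>\<^sup>+x. (\<integral>\<^sup>+z. F z \<partial>lborel) * indicator {0..1::real} x \<partial>lborel)"
    by (intro nn_integral_cong) (simp add: nn_integral_multc inv)
  also have "\<dots> = (\<integral>\<^sup>+z. F z \<partial>lborel)"
    by (subst nn_integral_cmult_indicator) auto
  finally show ?thesis by simp
qed

section \<open>Circle averages\<close>

text \<open>The unit circle with period 1, so that an integral over \<open>{0..1}\<close> is a
  normalised mean.\<close>

definition circle_pt :: "real \<Rightarrow> complex" where
  "circle_pt x = exp (2 * of_real pi * \<i> * of_real x)"

lemma norm_circle_pt [simp]: "cmod (circle_pt x) = 1"
  by (simp add: circle_pt_def norm_exp_eq_Re)

lemma circle_pt_nonzero [simp]: "circle_pt x \<noteq> 0"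
  by (simp add: circle_pt_def)

lemma circle_pt_0 [simp]: "circle_pt 0 = 1"
  by (simp add: circle_pt_def)

lemma circle_pt_1 [simp]: "circle_pt 1 = 1"
  by (simp add: circle_pt_def)

lemma continuous_on_circle_pt [continuous_intros]:
  "continuous_on S f \<Longrightarrow> continuous_on S (\<lambda>x. circle_pt (f x))"
  unfolding circle_pt_def by (intro continuous_intros)

lemma has_vector_derivative_circle_pt:
  "(circle_pt has_vector_derivative 2 * of_real pi * \<i> * circle_pt x) (at x within S)"
  unfolding circle_pt_def
  by (rule has_vector_derivative_real_field) (auto intro!: derivative_eq_intros)

lemma circlepath_eq: "circlepath a t = (\<lambda>x. a + circle_pt x * of_real t)"
  by (auto simp: circlepath circle_pt_def)

text \<open>The radius \<open>v\<close> is complex: with \<open>v = z - a\<close> the loop starts at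
  \<open>z\<close> itself, which matches the rotation average of the plane.\<close>

lemma valid_path_circle_pt: "valid_path (\<lambda>x. a + circle_pt x * v)"
proof -
  have "valid_path ((\<lambda>u. a + u * v) \<circ> circlepath 0 1)"
    by (rule valid_path_compose_holomorphic[where S = UNIV]) (auto intro!: holomorphic_intros)
  then show ?thesis
    by (simp add: o_def circlepath_eq)
qed

text \<open>On this loop \<open>dw = 2 * pi * \<i> * (w - a) dx\<close>, whence the factor
  \<open>w - a\<close>.\<close>

lemma contour_integral_circle_pt:
  "contour_integral (\<lambda>x. a + circle_pt x * v) f
     = 2 * of_real pi * \<i> * integral {0..1} (\<lambda>x. (\<lambda>w. (w - a) * f w) (a + circle_pt x * v))"
proof -
  have "vector_derivative (\<lambda>x. a + circle_pt x * v) (at x) = 2 * of_real pi * \<i> * circle_pt x * v" for x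
    by (rule vector_derivative_at) (auto intro!: derivative_eq_intros has_vector_derivative_circle_pt)
  then have "contour_integral (\<lambda>x. a + circle_pt x * v) f
      = integral {0..1} (\<lambda>x. (2 * of_real pi * \<i>) * (circle_pt x * v * f (a + circle_pt x * v)))"
    by (simp add: contour_integral_integral mult_ac)
  then show ?thesis by simp
qed

section \<open>Mean square inequalities on circles and discs\<close>

text \<open>Cauchy-Schwarz on the unit interval, obtained from the nonnegativity of the variance of
  \<open>cmod (g x)\<close> about its mean \<open>m\<close>.\<close>

lemma mean_square_le_nn_integral:
  fixes g :: "real \<Rightarrow> complex"
  assumes g: "continuous_on {0..1} g"
  shows "ennreal ((cmod (integral {0..1} g))\<^sup>2) \<le> (\<integral>\<^sup>+x\<in>{0..1}. ennreal ((cmod (g x))\<^sup>2) \<partial>lborel)"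
proof -
  define m where "m = integral {0..1} (\<lambda>x. cmod (g x))"
  have int: "h integrable_on {0..1}" if "continuous_on {0..1} h" for h :: "real \<Rightarrow> real"
    using that by (rule integrable_continuous_real)
  have "cmod (integral {0..1} g) \<le> m"
    unfolding m_def by (rule integral_norm_bound_integral)
      (use g in \<open>auto intro!: integrable_continuous_real continuous_intros\<close>)
  then have 1: "(cmod (integral {0..1} g))\<^sup>2 \<le> m\<^sup>2"
    by (intro power_mono) auto
  have "0 \<le> integral {0..1} (\<lambda>x. (cmod (g x) - m)\<^sup>2)"
    by (rule integral_nonneg) (use g in \<open>auto intro!: int continuous_intros\<close>)
  also have "\<dots> = integral {0..1} (\<lambda>x. (cmod (g x))\<^sup>2 - (2 * m) * cmod (g x) + m\<^sup>2)"
    by (simp add: power2_diff algebra_simps)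
  also have "\<dots> = integral {0..1} (\<lambda>x. (cmod (g x))\<^sup>2) - (2 * m) * m + m\<^sup>2"
    unfolding m_def
    by (subst integral_add, (use g in \<open>auto intro!: int continuous_intros\<close>)[2],
        subst integral_diff, (use g in \<open>auto intro!: int continuous_intros\<close>)[2]) simp
  finally have 2: "m\<^sup>2 \<le> integral {0..1} (\<lambda>x. (cmod (g x))\<^sup>2)"
    by (simp add: power2_eq_square)
  have si: "set_integrable lborel {0..1} (\<lambda>x. (cmod (g x))\<^sup>2)"
    by (rule borel_integrable_atLeastAtMost') (use g in \<open>auto intro!: continuous_intros\<close>)
  have "(\<integral>\<^sup>+x\<in>{0..1}. ennreal ((cmod (g x))\<^sup>2) \<partial>lborel)
      = (\<integral>\<^sup>+x. ennreal (indicator {0..1} x *\<^sub>R (cmod (g x))\<^sup>2) \<partial>lborel)"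
    by (intro nn_integral_cong) (auto simp: indicator_def)
  also have "\<dots> = ennreal (LINT x:{0..1}|lborel. (cmod (g x))\<^sup>2)"
    using si unfolding set_integrable_def set_lebesgue_integral_def
    by (intro nn_integral_eq_integral) auto
  also have "(LINT x:{0..1}|lborel. (cmod (g x))\<^sup>2) = integral {0..1} (\<lambda>x. (cmod (g x))\<^sup>2)"
    using si by (rule set_borel_integral_eq_integral)
  finally show ?thesis
    using 1 2 by (auto intro: ennreal_leI)
qed

text \<open>Common pattern of the disc and the annulus estimates: a bound by the mean of the square
  of \<open>cmod f\<close> over the circle through \<open>z\<close> is integrated in
  \<open>z\<close>. Invariance of \<open>U\<close> under rotation lets the function cut off outside
  \<open>U\<close> pass through the circle average.\<close>

lemma nn_integral_le_of_circle_average: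
  fixes f :: "complex \<Rightarrow> complex"
  assumes [measurable]: "U \<in> sets borel" and f: "continuous_on U f"
    and inv: "\<And>z x. a + circle_pt x * (z - a) \<in> U \<longleftrightarrow> z \<in> U"
    and q: "\<And>z. z \<in> U \<Longrightarrow> q z \<le>
          (\<integral>\<^sup>+x\<in>{0..1}. ennreal ((cmod (f (a + circle_pt x * (z - a))))\<^sup>2) \<partial>lborel)"
  shows "(\<integral>\<^sup>+z\<in>U. q z \<partial>lborel) \<le> (\<integral>\<^sup>+z\<in>U. ennreal ((cmod (f z))\<^sup>2) \<partial>lborel)"
proof -
  define F where "F z = ennreal (indicator U z *\<^sub>R (cmod (f z))\<^sup>2)" for z
  have "(\<lambda>z. indicator U z *\<^sub>R (cmod (f z))\<^sup>2) \<in> borel_measurable borel"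
    using f by (intro borel_measurable_continuous_on_indicator) (auto intro!: continuous_intros)
  then have F: "F \<in> borel_measurable borel"
    unfolding F_def by measurable
  have "(\<integral>\<^sup>+z\<in>U. q z \<partial>lborel)
     \<le> (\<integral>\<^sup>+z. (\<integral>\<^sup>+x\<in>{0..1}. F (a + circle_pt x * (z - a)) \<partial>lborel) \<partial>lborel)"
  proof (rule nn_integral_mono)
    fix z
    show "q z * indicator U z \<le> (\<integral>\<^sup>+x\<in>{0..1}. F (a + circle_pt x * (z - a)) \<partial>lborel)"
      using q[of z] by (cases "z \<in> U") (auto simp: F_def inv)
  qed
  also have "\<dots> = (\<integral>\<^sup>+z. F z \<partial>lborel)"
    using nn_integral_circle_average[OF F, of a] by (simp add: circle_pt_def)
  also have "\<dots> = (\<integral>\<^sup>+z\<in>U. ennreal ((cmod (f z))\<^sup>2) \<partial>lborel)"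
    by (intro nn_integral_cong) (auto simp: F_def indicator_def)
  finally show ?thesis .
qed

lemma circle_mean_value:
  assumes f: "f holomorphic_on ball a d" and v: "cmod v < d"
  shows "integral {0..1} (\<lambda>x. f (a + circle_pt x * v)) = f a"
proof -
  \<comment> \<open>Rescaling by the complex radius \<open>v\<close> turns the claim into Cauchy's
    formula at the centre of the unit disc.\<close>
  define F where "F u = f (a + u * v)" for u
  have "F holomorphic_on cball 0 1"
    unfolding F_def
  proof (rule holomorphic_on_compose_gen[OF _ f, unfolded o_def])
    show "(\<lambda>u. a + u * v) holomorphic_on cball 0 1"
      by (intro holomorphic_intros)
    show "(\<lambda>u. a + u * v) ` cball 0 1 \<subseteq> ball a d"
    proof safe
      fix u :: complex assume "u \<in> cball 0 1"
      then have "cmod (u * v) \<le> 1 * cmod v"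
        unfolding norm_mult by (intro mult_right_mono) auto
      then show "a + u * v \<in> ball a d"
        using v by (simp add: dist_norm)
    qed
  qed
  then have "((\<lambda>u. F u / (u - 0)) has_contour_integral 2 * of_real pi * \<i> * F 0) (circlepath 0 1)"
    by (intro Cauchy_integral_circlepath_simple) auto
  from contour_integral_unique[OF this]
  have "contour_integral (\<lambda>x. 0 + circle_pt x * 1) (\<lambda>u. F u / u) = 2 * of_real pi * \<i> * F 0"
    by (simp add: circlepath_eq)
  then show ?thesis
    by (subst (asm) contour_integral_circle_pt) (simp add: F_def)
qed

lemma emeasure_ball_complex:
  "0 \<le> d \<Longrightarrow> emeasure lborel (ball (a::complex) d) = ennreal (pi * d\<^sup>2)"
  by (simp add: emeasure_ball unit_ball_vol_2)

text \<open>The mean value property and Cauchy-Schwarz hold on every circle about \<open>a\<close>;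
  the circle average sums them up over the disc. This makes point evaluations bounded.\<close>

lemma square_norm_le_nn_integral_ball:
  assumes f: "f holomorphic_on ball a d" and d: "0 < d"
  shows "ennreal (pi * d\<^sup>2 * (cmod (f a))\<^sup>2) \<le> (\<integral>\<^sup>+z\<in>ball a d. ennreal ((cmod (f z))\<^sup>2) \<partial>lborel)"
proof -
  have cf: "continuous_on (ball a d) f"
    using f by (rule holomorphic_on_imp_continuous_on)
  have "ennreal (pi * d\<^sup>2 * (cmod (f a))\<^sup>2)
     = (\<integral>\<^sup>+z\<in>ball a d. ennreal ((cmod (f a))\<^sup>2) \<partial>lborel)"
    using d by (subst nn_integral_cmult_indicator)
      (simp_all add: emeasure_ball_complex mult.commute flip: ennreal_mult)
  also have "\<dots> \<le> (\<integral>\<^sup>+z\<in>ball a d. ennreal ((cmod (f z))\<^sup>2) \<partial>lborel)"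
  proof (rule nn_integral_le_of_circle_average[where a = a])
    fix z assume z: "z \<in> ball a d"
    have "continuous_on {0..1} (\<lambda>x. f (a + circle_pt x * (z - a)))"
      by (rule continuous_on_compose2[OF cf]) (use z in \<open>auto intro!: continuous_intros simp: dist_norm norm_mult norm_minus_commute\<close>)
    from mean_square_le_nn_integral[OF this]
    show "ennreal ((cmod (f a))\<^sup>2) \<le>
       (\<integral>\<^sup>+x\<in>{0..1}. ennreal ((cmod (f (a + circle_pt x * (z - a))))\<^sup>2) \<partial>lborel)"
      using z by (subst (asm) circle_mean_value[OF f]) (auto simp: dist_norm norm_minus_commute)
  qed (use cf in \<open>auto simp: dist_norm norm_mult norm_minus_commute\<close>)
  finally show ?thesis .
qed

section \<open>The reproducing kernel\<close>

definition l2_sq :: "complex set \<Rightarrow> (complex \<Rightarrow> complex) \<Rightarrow> real" where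
  "l2_sq \<Omega> f = (LINT \<zeta>:\<Omega>|lborel. (cmod (f \<zeta>))\<^sup>2)"

lemma l2_sq_nonneg [simp]: "0 \<le> l2_sq \<Omega> f"
  unfolding l2_sq_def set_lebesgue_integral_def by (rule integral_nonneg_AE) auto

lemma borel_measurable_indicator_times:
  fixes f :: "complex \<Rightarrow> 'b::real_normed_vector"
  assumes "open \<Omega>" "continuous_on \<Omega> f"
  shows "(\<lambda>x. indicator \<Omega> x *\<^sub>R f x) \<in> borel_measurable lborel"
proof -
  have "(\<lambda>x. indicator \<Omega> x *\<^sub>R f x) \<in> borel_measurable borel"
    using assms by (intro borel_measurable_continuous_on_indicator) auto
  then show ?thesis by simp
qed

lemma nn_integral_bergman_space:
  assumes "f \<in> bergman_space \<Omega>"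
  shows "(\<integral>\<^sup>+z\<in>\<Omega>. ennreal ((cmod (f z))\<^sup>2) \<partial>lborel) = ennreal (l2_sq \<Omega> f)"
proof -
  have "(\<integral>\<^sup>+z\<in>\<Omega>. ennreal ((cmod (f z))\<^sup>2) \<partial>lborel)
      = (\<integral>\<^sup>+x. ennreal (indicator \<Omega> x *\<^sub>R (cmod (f x))\<^sup>2) \<partial>lborel)"
    by (intro nn_integral_cong) (auto simp: indicator_def)
  also have "\<dots> = ennreal (l2_sq \<Omega> f)"
    using assms unfolding l2_sq_def bergman_space_def set_integrable_def set_lebesgue_integral_def
    by (intro nn_integral_eq_integral) auto
  finally show ?thesis .
qed

text \<open>Membership has to come with the bound: \<open>l2_sq\<close> of a function that is not
  square integrable is 0 by convention, whereas the nonnegative integral really detects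
  integrability.\<close>

lemma bergman_spaceI_nn_integral:
  assumes "open \<Omega>" and f: "f holomorphic_on \<Omega>"
    and le: "(\<integral>\<^sup>+z\<in>\<Omega>. ennreal ((cmod (f z))\<^sup>2) \<partial>lborel) \<le> ennreal B" and B: "0 \<le> B"
  shows "f \<in> bergman_space \<Omega>" "l2_sq \<Omega> f \<le> B"
proof -
  have cf: "continuous_on \<Omega> (\<lambda>z. (cmod (f z))\<^sup>2)"
    using holomorphic_on_imp_continuous_on[OF f] by (intro continuous_intros)
  have "(\<integral>\<^sup>+x. ennreal (norm (indicator \<Omega> x *\<^sub>R (cmod (f x))\<^sup>2)) \<partial>lborel)
      = (\<integral>\<^sup>+z\<in>\<Omega>. ennreal ((cmod (f z))\<^sup>2) \<partial>lborel)"
    by (intro nn_integral_cong) (auto simp: indicator_def)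
  also have "\<dots> < \<infinity>"
    using le by (auto simp: less_top[symmetric] top_unique)
  finally have "set_integrable lborel \<Omega> (\<lambda>z. (cmod (f z))\<^sup>2)"
    unfolding set_integrable_def
    by (intro integrableI_bounded borel_measurable_indicator_times[OF assms(1) cf])
  then show *: "f \<in> bergman_space \<Omega>"
    using f by (simp add: bergman_space_def)
  show "l2_sq \<Omega> f \<le> B"
    using le B unfolding nn_integral_bergman_space[OF *] by simp
qed

lemma square_norm_le_l2_sq:
  assumes f: "f \<in> bergman_space \<Omega>" and d: "0 < d" "ball w d \<subseteq> \<Omega>"
  shows "pi * d\<^sup>2 * (cmod (f w))\<^sup>2 \<le> l2_sq \<Omega> f"
proof -
  have "f holomorphic_on ball w d"
    using f d by (auto simp: bergman_space_def intro: holomorphic_on_subset)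
  then have "ennreal (pi * d\<^sup>2 * (cmod (f w))\<^sup>2) \<le> (\<integral>\<^sup>+z\<in>ball w d. ennreal ((cmod (f z))\<^sup>2) \<partial>lborel)"
    using d by (intro square_norm_le_nn_integral_ball)
  also have "\<dots> \<le> (\<integral>\<^sup>+z\<in>\<Omega>. ennreal ((cmod (f z))\<^sup>2) \<partial>lborel)"
    using d by (intro nn_integral_mono) (auto simp: indicator_def)
  finally show ?thesis
    by (simp add: nn_integral_bergman_space[OF f])
qed

lemma set_integrable_bergman_product:
  assumes "open \<Omega>" "f \<in> bergman_space \<Omega>" "g \<in> bergman_space \<Omega>"
  shows "set_integrable lborel \<Omega> (\<lambda>z. f z * cnj (g z))"
proof -
  have "continuous_on \<Omega> f" "continuous_on \<Omega> g"
    using assms by (auto simp: bergman_space_def intro: holomorphic_on_imp_continuous_on)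
  then have c: "continuous_on \<Omega> (\<lambda>z. f z * cnj (g z))"
    by (intro continuous_intros)
  have i: "set_integrable lborel \<Omega> (\<lambda>z. (cmod (f z))\<^sup>2 + (cmod (g z))\<^sup>2)"
    using assms by (intro set_integral_add(1)) (auto simp: bergman_space_def)
  have le: "cmod (u * cnj v) \<le> (cmod u)\<^sup>2 + (cmod v)\<^sup>2" for u v
  proof -
    have "0 \<le> cmod u * cmod v" by simp
    then show ?thesis
      using sum_squares_bound[of "cmod u" "cmod v"] by (simp only: norm_mult complex_mod_cnj)
  qed
  show ?thesis
    unfolding set_integrable_def
  proof (rule Bochner_Integration.integrable_bound[OF i[unfolded set_integrable_def]])
    show "(\<lambda>x. indicat_real \<Omega> x *\<^sub>R (f x * cnj (g x))) \<in> borel_measurable lborel"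
      using assms(1) c by (rule borel_measurable_indicator_times)
    show "AE x in lborel. norm (indicat_real \<Omega> x *\<^sub>R (f x * cnj (g x)))
        \<le> norm (indicat_real \<Omega> x *\<^sub>R ((cmod (f x))\<^sup>2 + (cmod (g x))\<^sup>2))"
      using le by (intro AE_I2) (auto simp: indicator_def)
  qed
qed

section \<open>Inner product structure and the reproducing function\<close>

text \<open>The pointwise expansion of the square is integrated. It serves as closure under linear
  combinations (with the zero function for \<open>f\<close> it gives multiples) and as the variation
  formula at a norm minimiser.\<close>

lemma l2_sq_add_scaled:
  assumes "open \<Omega>" and f: "f \<in> bergman_space \<Omega>" and g: "g \<in> bergman_space \<Omega>"
  shows "(\<lambda>z. f z + t * g z) \<in> bergman_space \<Omega>"
    and "l2_sq \<Omega> (\<lambda>z. f z + t * g z)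
      = l2_sq \<Omega> f + 2 * Re (t * (LINT z:\<Omega>|lborel. g z * cnj (f z))) + (cmod t)\<^sup>2 * l2_sq \<Omega> g"
proof -
  have eq: "(cmod (u + t * v))\<^sup>2 = (cmod u)\<^sup>2 + 2 * Re (t * (v * cnj u)) + (cmod t)\<^sup>2 * (cmod v)\<^sup>2" for u v
  proof -
    have "(cmod (u + t * v))\<^sup>2 = (cmod u)\<^sup>2 + (cmod (t * v))\<^sup>2 + 2 * Re (t * v * cnj u)"
      unfolding cmod_power2 by (simp add: power2_eq_square algebra_simps)
    then show ?thesis
      by (simp add: norm_mult power_mult_distrib mult.assoc)
  qed
  have 1: "has_bochner_integral lborel (\<lambda>z. indicator \<Omega> z *\<^sub>R (cmod (h z))\<^sup>2) (l2_sq \<Omega> h)"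
    if "h \<in> bergman_space \<Omega>" for h
    using that unfolding l2_sq_def bergman_space_def set_integrable_def set_lebesgue_integral_def
    by (auto intro: has_bochner_integral_integrable)
  have "has_bochner_integral lborel (\<lambda>z. indicator \<Omega> z *\<^sub>R (g z * cnj (f z)))
      (LINT z:\<Omega>|lborel. g z * cnj (f z))"
    using set_integrable_bergman_product[OF assms(1) g f]
    unfolding set_integrable_def set_lebesgue_integral_def by (rule has_bochner_integral_integrable)
  then have "has_bochner_integral lborel (\<lambda>z. 2 * Re (t * (indicator \<Omega> z *\<^sub>R (g z * cnj (f z)))))
      (2 * Re (t * (LINT z:\<Omega>|lborel. g z * cnj (f z))))"
    by (intro has_bochner_integral_mult_right has_bochner_integral_bounded_linear[OF bounded_linear_Re])
  from has_bochner_integral_add[OF has_bochner_integral_add[OF 1[OF f] this]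
      has_bochner_integral_mult_right[OF 1[OF g], of "(cmod t)\<^sup>2"]]
  have *: "has_bochner_integral lborel (\<lambda>z. indicator \<Omega> z *\<^sub>R (cmod (f z + t * g z))\<^sup>2)
    (l2_sq \<Omega> f + 2 * Re (t * (LINT z:\<Omega>|lborel. g z * cnj (f z))) + (cmod t)\<^sup>2 * l2_sq \<Omega> g)"
    by (rule has_bochner_integral_cong[THEN iffD1, rotated -1])
       (auto simp: indicator_def eq split: if_splits)
  show "(\<lambda>z. f z + t * g z) \<in> bergman_space \<Omega>"
    using * f g unfolding bergman_space_def set_integrable_def
    by (auto simp: has_bochner_integral_iff intro!: holomorphic_intros)
  show "l2_sq \<Omega> (\<lambda>z. f z + t * g z)
      = l2_sq \<Omega> f + 2 * Re (t * (LINT z:\<Omega>|lborel. g z * cnj (f z))) + (cmod t)\<^sup>2 * l2_sq \<Omega> g"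
    using * by (simp add: has_bochner_integral_iff l2_sq_def set_lebesgue_integral_def)
qed

lemma l2_sq_eq_inner: "(LINT z:\<Omega>|lborel. f z * cnj (f z)) = of_real (l2_sq \<Omega> f)"
proof -
  have "(LINT z:\<Omega>|lborel. f z * cnj (f z))
      = (LINT z|lborel. complex_of_real (indicator \<Omega> z *\<^sub>R (cmod (f z))\<^sup>2))"
    unfolding set_lebesgue_integral_def
    by (intro Bochner_Integration.integral_cong) (auto simp: complex_norm_square[symmetric] indicator_def)
  then show ?thesis
    by (simp only: integral_complex_of_real l2_sq_def set_lebesgue_integral_def)
qed

lemma zero_in_bergman_space: "(\<lambda>z. 0) \<in> bergman_space \<Omega>"
  by (simp add: bergman_space_def set_integrable_def)

text \<open>The disc estimate controls each value by the norm, so the conclusion holds at every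
  point of \<open>\<Omega>\<close> and not just almost everywhere.\<close>

lemma l2_sq_zero_imp_zero:
  assumes "open \<Omega>" "f \<in> bergman_space \<Omega>" "l2_sq \<Omega> f = 0" "w \<in> \<Omega>"
  shows "f w = 0"
proof -
  obtain d where d: "0 < d" "ball w d \<subseteq> \<Omega>"
    using assms openE by blast
  have "pi * d\<^sup>2 * (cmod (f w))\<^sup>2 \<le> 0"
    using square_norm_le_l2_sq[OF assms(2) d] assms by simp
  moreover have "pi * d\<^sup>2 > 0"
    using d by simp
  ultimately have "(cmod (f w))\<^sup>2 \<le> 0"
    by (metis mult_le_0_iff not_less)
  then show ?thesis by simp
qed

text \<open>Instead of completeness of the Bergman space, the minimiser is extracted from a minimising
  sequence by Montel's theorem, and Fatou's lemma shows that the limit is still minimal.\<close>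

lemma bergman_minimiser_exists:
  assumes "open \<Omega>" "w \<in> \<Omega>" and g: "g \<in> bergman_space \<Omega>" "g w = 1"
  obtains f where "f \<in> bergman_space \<Omega>" "f w = 1"
    "\<And>h. h \<in> bergman_space \<Omega> \<Longrightarrow> h w = 1 \<Longrightarrow> l2_sq \<Omega> f \<le> l2_sq \<Omega> h"
proof -
  define S where "S = {h \<in> bergman_space \<Omega>. h w = 1}"
  define m where "m = Inf (l2_sq \<Omega> ` S)"
  have ne: "l2_sq \<Omega> ` S \<noteq> {}" and bdd: "bdd_below (l2_sq \<Omega> ` S)"
    using g by (auto simp: S_def intro!: bdd_belowI[of _ 0])
  have m_le: "m \<le> l2_sq \<Omega> h" if "h \<in> S" for h
    unfolding m_def using that bdd by (intro cInf_lower) auto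
  have m0: "0 \<le> m"
    unfolding m_def using ne by (intro cInf_greatest) auto
  have "\<exists>h\<in>S. l2_sq \<Omega> h < m + 1 / real (Suc n)" for n
    using cInf_lessD[OF ne, of "m + 1 / real (Suc n)"] unfolding m_def by auto
  then obtain F where F: "\<And>n. F n \<in> S" "\<And>n. l2_sq \<Omega> (F n) < m + 1 / real (Suc n)"
    by metis
  \<comment> \<open>Every \<open>F n\<close> has squared norm at most \<open>m + 1\<close>, because
    \<open>1 / real (Suc n)\<close> is at most 1. The whole norm-bounded set \<open>H\<close> is the
    family fed to Montel's theorem.\<close>
  define H where "H = {h \<in> bergman_space \<Omega>. l2_sq \<Omega> h \<le> m + 1}"
  have FH: "range F \<subseteq> H"
  proof safe
    fix n
    have "1 / real (Suc n) \<le> 1" by simp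
    then have "l2_sq \<Omega> (F n) \<le> m + 1" using F(2)[of n] by linarith
    then show "F n \<in> H" using F(1)[of n] by (simp add: H_def S_def)
  qed
  \<comment> \<open>Local boundedness: one radius \<open>d\<close> works for all centres in the
    compact set, and the disc estimate turns the norm bound into a uniform bound.\<close>
  have bnd: "\<exists>B. \<forall>h\<in>H. \<forall>z\<in>K. cmod (h z) \<le> B" if K: "compact K" "K \<subseteq> \<Omega>" for K
  proof -
    obtain d where d: "0 < d" "\<And>z. z \<in> K \<Longrightarrow> ball z d \<subseteq> \<Omega>"
      using compact_subset_open_imp_ball_epsilon_subset[OF K(1) assms(1) K(2)]
      by (metis UN_subset_iff)
    have "cmod (h z) \<le> sqrt ((m + 1) / (pi * d\<^sup>2))" if "h \<in> H" "z \<in> K" for h z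
    proof -
      have "pi * d\<^sup>2 * (cmod (h z))\<^sup>2 \<le> m + 1"
        using square_norm_le_l2_sq[of h \<Omega> d z] that d by (auto simp: H_def)
      then show ?thesis
        using d by (intro real_le_rsqrt) (simp add: field_simps)
    qed
    then show ?thesis by blast
  qed
  have holH: "h holomorphic_on \<Omega>" if "h \<in> H" for h
    using that by (auto simp: H_def bergman_space_def)
  obtain f r where f: "f holomorphic_on \<Omega>" and r: "strict_mono (r :: nat \<Rightarrow> nat)"
    and lim: "\<And>x. x \<in> \<Omega> \<Longrightarrow> (\<lambda>n. F (r n) x) \<longlonglongrightarrow> f x"
    by (rule Montel[OF assms(1) holH bnd FH], assumption+, rule that)
  have "(\<lambda>n. F (r n) w) \<longlonglongrightarrow> 1"
    using F(1) by (simp add: S_def)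
  with lim[OF assms(2)] have fw: "f w = 1"
    by (metis LIMSEQ_unique)
  have Fb: "F n \<in> bergman_space \<Omega>" for n
    using F(1)[of n] by (simp add: S_def)
  have cF: "continuous_on \<Omega> (\<lambda>z. (cmod (F n z))\<^sup>2)" for n
    using Fb[of n] unfolding bergman_space_def
    by (auto intro!: continuous_intros holomorphic_on_imp_continuous_on)
  have "(\<integral>\<^sup>+z\<in>\<Omega>. ennreal ((cmod (f z))\<^sup>2) \<partial>lborel)
     = (\<integral>\<^sup>+z. liminf (\<lambda>n. ennreal (indicator \<Omega> z *\<^sub>R (cmod (F (r n) z))\<^sup>2)) \<partial>lborel)"
  proof (rule nn_integral_cong)
    fix z
    show "ennreal ((cmod (f z))\<^sup>2) * indicator \<Omega> z
      = liminf (\<lambda>n. ennreal (indicator \<Omega> z *\<^sub>R (cmod (F (r n) z))\<^sup>2))"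
    proof (cases "z \<in> \<Omega>")
      case True
      have "(\<lambda>n. ennreal ((cmod (F (r n) z))\<^sup>2)) \<longlonglongrightarrow> ennreal ((cmod (f z))\<^sup>2)"
        by (intro tendsto_ennrealI tendsto_intros lim True)
      from lim_imp_Liminf[OF _ this] show ?thesis
        using True by simp
    qed (simp add: Liminf_const)
  qed
  also have "\<dots> \<le> liminf (\<lambda>n. \<integral>\<^sup>+z. ennreal (indicator \<Omega> z *\<^sub>R (cmod (F (r n) z))\<^sup>2) \<partial>lborel)"
    by (intro nn_integral_liminf measurable_compose[OF _ measurable_ennreal]
        borel_measurable_indicator_times[OF assms(1) cF])
  also have "\<dots> = liminf (\<lambda>n. ennreal (l2_sq \<Omega> (F (r n))))"
  proof -
    have "(\<integral>\<^sup>+z. ennreal (indicator \<Omega> z *\<^sub>R (cmod (F n z))\<^sup>2) \<partial>lborel) = ennreal (l2_sq \<Omega> (F n))" for n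
      unfolding nn_integral_bergman_space[OF Fb, symmetric]
      by (intro nn_integral_cong) (auto simp: indicator_def)
    then show ?thesis by simp
  qed
  also have "\<dots> \<le> liminf (\<lambda>n. ennreal (m + 1 / real (Suc (r n))))"
    using F(2) by (intro Liminf_mono always_eventually allI ennreal_leI less_imp_le)
  also have "\<dots> = ennreal m"
  proof -
    have "(\<lambda>n. 1 / real (Suc (r n))) \<longlonglongrightarrow> 0"
      using LIMSEQ_subseq_LIMSEQ[OF LIMSEQ_inverse_real_of_nat r]
      by (simp add: o_def inverse_eq_divide)
    then have "(\<lambda>n. m + 1 / real (Suc (r n))) \<longlonglongrightarrow> m + 0"
      by (intro tendsto_intros)
    then have "(\<lambda>n. ennreal (m + 1 / real (Suc (r n)))) \<longlonglongrightarrow> ennreal m"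
      by (intro tendsto_ennrealI) simp
    then show ?thesis
      by (simp add: lim_imp_Liminf)
  qed
  finally have le: "(\<integral>\<^sup>+z\<in>\<Omega>. ennreal ((cmod (f z))\<^sup>2) \<partial>lborel) \<le> ennreal m" .
  show thesis
  proof (rule that)
    show "f \<in> bergman_space \<Omega>"
      using bergman_spaceI_nn_integral(1)[OF assms(1) f le m0] .
    show "l2_sq \<Omega> f \<le> l2_sq \<Omega> h" if "h \<in> bergman_space \<Omega>" "h w = 1" for h
      using bergman_spaceI_nn_integral(2)[OF assms(1) f le m0] m_le[of h] that by (simp add: S_def)
  qed fact
qed

text \<open>Riesz representation of the evaluation at \<open>w\<close>, done by hand. If every
  function vanishes at \<open>w\<close>, zero represents it. Otherwise the minimiser
  \<open>f\<close> under the constraint \<open>f w = 1\<close> is orthogonal to all functions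
  vanishing at \<open>w\<close>, and dividing it by its squared norm gives \<open>k\<close>.\<close>

lemma reproducing_function_exists:
  assumes "open \<Omega>" "w \<in> \<Omega>"
  obtains k where "k \<in> bergman_space \<Omega>"
    "\<And>f. f \<in> bergman_space \<Omega> \<Longrightarrow> f w = (LINT z:\<Omega>|lborel. f z * cnj (k z))"
proof (cases "\<exists>g\<in>bergman_space \<Omega>. g w \<noteq> 0")
  case False
  then show thesis
    using that[of "\<lambda>z. 0"] zero_in_bergman_space by simp
next
  case True
  then obtain g0 where g0: "g0 \<in> bergman_space \<Omega>" "g0 w \<noteq> 0" by blast
  define g where "g z = 0 + (1 / g0 w) * g0 z" for z
  have g: "g \<in> bergman_space \<Omega>" "g w = 1"
    using l2_sq_add_scaled(1)[OF assms(1) zero_in_bergman_space g0(1), of "1 / g0 w"] g0 by (auto simp: g_def[abs_def])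
  obtain f where f: "f \<in> bergman_space \<Omega>" "f w = 1"
    and min: "\<And>h. h \<in> bergman_space \<Omega> \<Longrightarrow> h w = 1 \<Longrightarrow> l2_sq \<Omega> f \<le> l2_sq \<Omega> h"
    using bergman_minimiser_exists[OF assms g] by blast
  define N where "N = l2_sq \<Omega> f"
  have "N \<noteq> 0"
    using l2_sq_zero_imp_zero[OF assms(1) f(1) _ assms(2)] f(2) by (auto simp: N_def)
  have orth: "(LINT z:\<Omega>|lborel. h z * cnj (f z)) = 0" if h: "h \<in> bergman_space \<Omega>" "h w = 0" for h
  proof (rule ccontr)
    define p where "p = (LINT z:\<Omega>|lborel. h z * cnj (f z))"
    \<comment> \<open>Moving from \<open>f\<close> by \<open>t * h\<close> changes the squared norm
      by a linear term \<open>- 2 * l * (cmod p)\<^sup>2\<close> and a quadratic one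
      \<open>l\<^sup>2 * (cmod p)\<^sup>2 * l2_sq \<Omega> h\<close>. The choice of \<open>l\<close>
      makes \<open>l * l2_sq \<Omega> h < 1\<close>, so the sum is negative, against minimality; the
      added 1 covers \<open>l2_sq \<Omega> h = 0\<close>.\<close>
    define l where "l = 1 / (l2_sq \<Omega> h + 1)"
    define t where "t = - (of_real l * cnj p)"
    assume "(LINT z:\<Omega>|lborel. h z * cnj (f z)) \<noteq> 0"
    then have p: "cmod p > 0" by (simp add: p_def)
    have l: "l > 0" "l * l2_sq \<Omega> h < 1"
      using add_nonneg_pos[OF l2_sq_nonneg[of \<Omega> h] zero_less_one] by (simp_all add: l_def)
    have "l2_sq \<Omega> f \<le> l2_sq \<Omega> (\<lambda>z. f z + t * h z)"
      using f h by (intro min l2_sq_add_scaled(1)[OF assms(1)]) auto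
    also have "\<dots> = l2_sq \<Omega> f + 2 * Re (t * p) + (cmod t)\<^sup>2 * l2_sq \<Omega> h"
      unfolding p_def by (rule l2_sq_add_scaled(2)[OF assms(1) f(1) h(1)])
    finally have "0 \<le> 2 * Re (t * p) + (cmod t)\<^sup>2 * l2_sq \<Omega> h" by simp
    also have "t * p = of_real (- l * (cmod p)\<^sup>2)"
      by (simp add: t_def complex_norm_square[symmetric] mult_ac del: of_real_power)
    also have "(cmod t)\<^sup>2 = l\<^sup>2 * (cmod p)\<^sup>2"
      by (simp add: t_def norm_mult power_mult_distrib)
    finally have "0 \<le> l * (cmod p)\<^sup>2 * (l * l2_sq \<Omega> h - 2)"
      by (simp add: algebra_simps power2_eq_square)
    moreover have "l * (cmod p)\<^sup>2 > 0" using p l by simp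
    ultimately show False
      using l by (simp add: zero_le_mult_iff)
  qed
  define k where "k z = 0 + of_real (1 / N) * f z" for z
  show thesis
  proof (rule that)
    show "k \<in> bergman_space \<Omega>"
      unfolding k_def[abs_def] by (rule l2_sq_add_scaled(1)[OF assms(1) zero_in_bergman_space f(1)])
    fix h assume h: "h \<in> bergman_space \<Omega>"
    \<comment> \<open>Subtracting \<open>h w\<close> times \<open>f\<close> produces a function
      vanishing at \<open>w\<close>, to which \<open>orth\<close> applies.\<close>
    have "(\<lambda>z. h z + (- h w) * f z) \<in> bergman_space \<Omega>"
      by (rule l2_sq_add_scaled(1)[OF assms(1) h f(1)])
    then have "0 = (LINT z:\<Omega>|lborel. (h z + (- h w) * f z) * cnj (f z))"
      using f by (subst orth) auto
    also have "\<dots> = (LINT z:\<Omega>|lborel. h z * cnj (f z) - h w * (f z * cnj (f z)))"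
      by (simp add: algebra_simps)
    also have "\<dots> = (LINT z:\<Omega>|lborel. h z * cnj (f z)) - h w * (LINT z:\<Omega>|lborel. f z * cnj (f z))"
      using set_integrable_bergman_product[OF assms(1) h f(1)]
        set_integrable_bergman_product[OF assms(1) f(1) f(1)]
      by (subst set_integral_diff(2)) (auto intro!: set_integrable_mult_right)
    also have "\<dots> = (LINT z:\<Omega>|lborel. h z * cnj (f z)) - h w * of_real N"
      by (simp add: l2_sq_eq_inner N_def)
    finally have "h w = (LINT z:\<Omega>|lborel. h z * cnj (f z)) * of_real (1 / N)"
      using \<open>N \<noteq> 0\<close> by (simp add: field_simps)
    also have "\<dots> = (LINT z:\<Omega>|lborel. h z * cnj (f z) * of_real (1 / N))"
      by (rule set_integral_mult_left[symmetric])
    also have "\<dots> = (LINT z:\<Omega>|lborel. h z * cnj (k z))"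
      by (simp add: k_def mult_ac)
    finally show "h w = (LINT z:\<Omega>|lborel. h z * cnj (k z))" .
  qed
qed

text \<open>The kernel on the diagonal equals both the value at \<open>w\<close> and the squared
  norm of the reproducing function \<open>k\<close>. Testing the evaluation bound on
  \<open>k\<close> itself therefore bounds the square of the kernel by \<open>B\<close> times the
  kernel.\<close>

lemma bergman_kernel_le:
  assumes "open \<Omega>" "w \<in> \<Omega>"
    and bound: "\<And>f. f \<in> bergman_space \<Omega> \<Longrightarrow> (cmod (f w))\<^sup>2 \<le> B * l2_sq \<Omega> f" and "0 \<le> B"
  shows "bergman_kernel \<Omega> w \<le> B"
proof -
  obtain k0 where k0: "k0 \<in> bergman_space \<Omega>"
    "\<And>f. f \<in> bergman_space \<Omega> \<Longrightarrow> f w = (LINT z:\<Omega>|lborel. f z * cnj (k0 z))"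
    using reproducing_function_exists[OF assms(1,2)] by blast
  \<comment> \<open>Membership in the space says nothing about values outside
    \<open>\<Omega>\<close>; the value 0 there is what makes the definite description in
    \<open>bergman_kernel2\<close> unique as a total function.\<close>
  define k where "k z = (if z \<in> \<Omega> then k0 z else 0)" for z
  define P where "P = (\<lambda>k. k \<in> bergman_space \<Omega> \<and> (\<forall>z. z \<notin> \<Omega> \<longrightarrow> k z = 0) \<and>
        (\<forall>f\<in>bergman_space \<Omega>. f w = (LINT \<xi>:\<Omega>|lborel. f \<xi> * cnj (k \<xi>))))"
  have kb: "k \<in> bergman_space \<Omega>"
  proof -
    have "k holomorphic_on \<Omega>"
      using k0(1) by (subst holomorphic_cong[OF refl, of _ _ k0]) (auto simp: k_def bergman_space_def)
    moreover have "set_integrable lborel \<Omega> (\<lambda>\<zeta>. (cmod (k \<zeta>))\<^sup>2)"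
      using k0(1) unfolding bergman_space_def set_integrable_def
      by (subst Bochner_Integration.integrable_cong[OF refl, of _ _ "\<lambda>x. indicat_real \<Omega> x *\<^sub>R (cmod (k0 x))\<^sup>2"])
         (auto simp: k_def indicator_def)
    ultimately show ?thesis by (simp add: bergman_space_def)
  qed
  have keq: "(LINT \<xi>:\<Omega>|lborel. f \<xi> * cnj (k \<xi>)) = (LINT \<xi>:\<Omega>|lborel. f \<xi> * cnj (k0 \<xi>))" for f
    unfolding set_lebesgue_integral_def
    by (intro Bochner_Integration.integral_cong) (auto simp: k_def indicator_def)
  have P: "P k"
    using kb k0(2) unfolding P_def keq by (auto simp: k_def)
  have "h = k" if h: "P h" for h
  proof
    fix x
    \<comment> \<open>Uniqueness: the inner product of the difference \<open>d\<close> with itself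
      splits into its products with \<open>h\<close> and with \<open>k\<close>, and both equal
      \<open>d w\<close>.\<close>
    define d where "d z = h z + (-1) * k z" for z
    have db: "d \<in> bergman_space \<Omega>"
      unfolding d_def[abs_def] using h P by (intro l2_sq_add_scaled(1)[OF assms(1)]) (auto simp: P_def)
    have "of_real (l2_sq \<Omega> d) = (LINT z:\<Omega>|lborel. d z * cnj (d z))"
      by (simp add: l2_sq_eq_inner)
    also have "\<dots> = (LINT z:\<Omega>|lborel. d z * cnj (h z) - d z * cnj (k z))"
      by (simp add: d_def algebra_simps)
    also have "\<dots> = (LINT z:\<Omega>|lborel. d z * cnj (h z)) - (LINT z:\<Omega>|lborel. d z * cnj (k z))"
      using h P db by (intro set_integral_diff set_integrable_bergman_product assms) (auto simp: P_def)
    also have "\<dots> = d w - d w"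
      using h P db by (simp add: P_def)
    finally have "l2_sq \<Omega> d = 0"
      by (simp only: diff_self of_real_eq_0_iff)
    then have "d x = 0" if "x \<in> \<Omega>"
      using l2_sq_zero_imp_zero[OF assms(1) db] that by simp
    then show "h x = k x"
      using h P by (cases "x \<in> \<Omega>") (auto simp: P_def d_def)
  qed
  then have "(THE k. P k) = k"
    using P by blast
  then have "bergman_kernel2 \<Omega> w w = k w"
    by (simp add: bergman_kernel2_def P_def)
  also have kw: "k w = of_real (l2_sq \<Omega> k)"
    using P kb l2_sq_eq_inner[of \<Omega> k] by (auto simp: P_def)
  finally have 1: "bergman_kernel \<Omega> w = l2_sq \<Omega> k"
    by (simp add: bergman_kernel_def)
  have "(l2_sq \<Omega> k)\<^sup>2 \<le> B * l2_sq \<Omega> k"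
    using bound[OF kb] by (simp add: kw)
  then have "l2_sq \<Omega> k \<le> B"
    using l2_sq_nonneg[of \<Omega> k] \<open>0 \<le> B\<close>
    by (cases "l2_sq \<Omega> k = 0") (auto simp: power2_eq_square mult_le_cancel_right)
  with 1 show ?thesis by simp
qed

section \<open>The kernel on an annulus\<close>

text \<open>A path from \<open>v\<close> to \<open>w\<close> inside the annulus, rotated through all
  angles, is a homotopy between the two loops. It never enters the hole, where \<open>f\<close> may
  fail to be holomorphic.\<close>

lemma contour_integral_circle_pt_eq:
  assumes S: "open S" "f holomorphic_on S"
    and A: "{z. s \<le> cmod (z - a) \<and> cmod (z - a) \<le> r} \<subseteq> S"
    and v: "s \<le> cmod v" "cmod v \<le> r" and w: "s \<le> cmod w" "cmod w \<le> r"
  shows "contour_integral (\<lambda>x. a + circle_pt x * v) f = contour_integral (\<lambda>x. a + circle_pt x * w) f"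
proof (rule Cauchy_theorem_homotopic_loops[OF _ S valid_path_circle_pt valid_path_circle_pt])
  have "path_connected {z::complex. s \<le> cmod (z - 0) \<and> cmod (z - 0) \<le> r}"
    by (intro path_connected_annulus) auto
  then have "\<exists>\<gamma>. path \<gamma> \<and> path_image \<gamma> \<subseteq> {z. s \<le> cmod (z - 0) \<and> cmod (z - 0) \<le> r}
      \<and> pathstart \<gamma> = v \<and> pathfinish \<gamma> = w"
    unfolding path_connected_def by (elim ballE[of _ _ v] ballE[of _ _ w]) (use v w in auto)
  then obtain \<gamma> where \<gamma>: "path \<gamma>" "path_image \<gamma> \<subseteq> {z. s \<le> cmod z \<and> cmod z \<le> r}"
      "pathstart \<gamma> = v" "pathfinish \<gamma> = w"
    unfolding diff_0_right by (elim exE conjE) (rule that)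
  have "continuous_on ({0..1} \<times> {0..1}) (\<lambda>p. a + circle_pt (snd p) * \<gamma> (fst p))"
    using \<gamma>(1) unfolding path_def
    by (intro continuous_intros continuous_on_compose2[of "{0..1}" \<gamma> _ fst]) auto
  moreover have "(\<lambda>p. a + circle_pt (snd p) * \<gamma> (fst p)) ` ({0..1} \<times> {0..1}) \<subseteq> S"
  proof safe
    fix t x :: real assume "t \<in> {0..1}"
    then have "\<gamma> t \<in> {z. s \<le> cmod z \<and> cmod z \<le> r}"
      using \<gamma>(2) unfolding path_image_def by blast
    then show "a + circle_pt (snd (t, x)) * \<gamma> (fst (t, x)) \<in> S"
      by (intro subsetD[OF A]) (auto simp: norm_mult)
  qed
  ultimately show "homotopic_loops S (\<lambda>x. a + circle_pt x * v) (\<lambda>x. a + circle_pt x * w)"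
    unfolding homotopic_loops using \<gamma>(3,4)
    by (intro exI[of _ "\<lambda>p. a + circle_pt (snd p) * \<gamma> (fst p)"])
       (auto simp: pathstart_def pathfinish_def)
qed

section \<open>The logarithmic area integral and the residue term\<close>

text \<open>On a shell with radii \<open>t\<close> and \<open>t * q\<close> the integrand is at
  least \<open>1 / (t * q)\<^sup>2\<close>, and the area is
  \<open>pi * t\<^sup>2 * (q\<^sup>2 - 1)\<close>. The product does not depend on \<open>t\<close>,
  so each of the \<open>n\<close> shells contributes the same amount.\<close>

lemma nn_integral_inverse_square_geometric:
  assumes s: "0 < s" and q: "1 < q"
  shows "ennreal (real n * (pi * (1 - 1 / q\<^sup>2)))
    \<le> (\<integral>\<^sup>+z\<in>{z. s \<le> cmod (z - a) \<and> cmod (z - a) < s * q ^ n}. ennreal (1 / (cmod (z - a))\<^sup>2) \<partial>lborel)"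
proof (induction n)
  case (Suc n)
  define t where "t = s * q ^ n"
  define A where "A = {z. s \<le> cmod (z - a) \<and> cmod (z - a) < t}"
  define B where "B = {z. t \<le> cmod (z - a) \<and> cmod (z - a) < t * q}"
  have t: "0 < t" "s \<le> t"
    using s q by (auto simp: t_def)
  have tq: "t \<le> t * q"
    using t q by simp
  have [measurable]: "A \<in> sets borel" "B \<in> sets borel"
    unfolding A_def B_def by measurable
  have un: "{z. s \<le> cmod (z - a) \<and> cmod (z - a) < s * q ^ Suc n} = A \<union> B"
    using t tq unfolding A_def B_def by (auto simp: t_def mult_ac)
  have "B = ball a (t * q) - ball a t"
    by (auto simp: B_def dist_norm norm_minus_commute)
  then have "emeasure lborel B = emeasure lborel (ball a (t * q)) - emeasure lborel (ball a t)"
    using t tq by (simp add: emeasure_Diff emeasure_ball_complex subset_ball)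
  also have "\<dots> = ennreal (pi * (t * q)\<^sup>2 - pi * t\<^sup>2)"
    using t tq by (simp add: emeasure_ball_complex ennreal_minus)
  finally have emB: "emeasure lborel B = ennreal (pi * (t * q)\<^sup>2 - pi * t\<^sup>2)" .
  have "ennreal (pi * (1 - 1 / q\<^sup>2)) = ennreal ((1 / (t * q)\<^sup>2) * (pi * (t * q)\<^sup>2 - pi * t\<^sup>2))"
    using t q by (intro arg_cong[of _ _ ennreal]) (simp add: field_simps)
  also have "\<dots> = ennreal (1 / (t * q)\<^sup>2) * emeasure lborel B"
    unfolding emB by (rule ennreal_mult'') (use t tq in \<open>auto intro!: mult_left_mono power_mono\<close>)
  also have "\<dots> = (\<integral>\<^sup>+z\<in>B. ennreal (1 / (t * q)\<^sup>2) \<partial>lborel)"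
    by (simp add: nn_integral_cmult_indicator)
  also have "\<dots> \<le> (\<integral>\<^sup>+z\<in>B. ennreal (1 / (cmod (z - a))\<^sup>2) \<partial>lborel)"
    using t q by (intro nn_integral_mono)
      (auto simp: B_def indicator_def intro!: ennreal_leI divide_left_mono power_mono mult_pos_pos zero_less_power)
  finally have 1: "ennreal (pi * (1 - 1 / q\<^sup>2)) \<le> (\<integral>\<^sup>+z\<in>B. ennreal (1 / (cmod (z - a))\<^sup>2) \<partial>lborel)" .
  have nn: "0 \<le> pi * (1 - 1 / q\<^sup>2)"
    using q by (simp add: field_simps)
  have "ennreal (real (Suc n) * (pi * (1 - 1 / q\<^sup>2)))
      = ennreal (real n * (pi * (1 - 1 / q\<^sup>2))) + ennreal (pi * (1 - 1 / q\<^sup>2))"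
    unfolding of_nat_Suc distrib_right mult_1_left add.commute[of 1]
    by (rule ennreal_plus) (use nn in \<open>auto intro!: mult_nonneg_nonneg\<close>)
  also have "\<dots> \<le> (\<integral>\<^sup>+z\<in>A. ennreal (1 / (cmod (z - a))\<^sup>2) \<partial>lborel)
      + (\<integral>\<^sup>+z\<in>B. ennreal (1 / (cmod (z - a))\<^sup>2) \<partial>lborel)"
    using Suc 1 unfolding A_def t_def by (intro add_mono)
  also have "\<dots> = (\<integral>\<^sup>+z\<in>A \<union> B. ennreal (1 / (cmod (z - a))\<^sup>2) \<partial>lborel)"
    by (rule nn_integral_disjoint_pair[symmetric]) (auto simp: A_def B_def)
  finally show ?case
    unfolding un .
qed simp

text \<open>The annulus is cut into \<open>Suc n\<close> shells of common ratio
  \<open>exp (l / real (Suc n))\<close>; as \<open>n\<close> grows the lower sums converge to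
  \<open>2 * pi * l\<close>.\<close>

lemma nn_integral_inverse_square_annulus:
  assumes s: "0 < s" "s < r"
  shows "ennreal (2 * pi * ln (r / s))
    \<le> (\<integral>\<^sup>+z\<in>{z. s \<le> cmod (z - a) \<and> cmod (z - a) \<le> r}. ennreal (1 / (cmod (z - a))\<^sup>2) \<partial>lborel)"
proof -
  define l where "l = ln (r / s)"
  have l: "l > 0" using s by (simp add: l_def)
  let ?I = "\<integral>\<^sup>+z\<in>{z. s \<le> cmod (z - a) \<and> cmod (z - a) \<le> r}. ennreal (1 / (cmod (z - a))\<^sup>2) \<partial>lborel"
  have le: "ennreal (real (Suc n) * (pi * (1 - 1 / (exp (l / real (Suc n)))\<^sup>2))) \<le> ?I" for n
  proof -
    have "exp (l / real (Suc n)) ^ Suc n = exp l"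
      by (subst exp_of_nat_mult[symmetric]) (simp del: of_nat_Suc)
    then have "s * exp (l / real (Suc n)) ^ Suc n = r"
      using s by (simp add: l_def)
    then have "ennreal (real (Suc n) * (pi * (1 - 1 / (exp (l / real (Suc n)))\<^sup>2)))
      \<le> (\<integral>\<^sup>+z\<in>{z. s \<le> cmod (z - a) \<and> cmod (z - a) < r}. ennreal (1 / (cmod (z - a))\<^sup>2) \<partial>lborel)"
      using nn_integral_inverse_square_geometric[OF s(1), of "exp (l / real (Suc n))" "Suc n" a] l by simp
    also have "\<dots> \<le> ?I"
      by (intro nn_integral_mono) (auto simp: indicator_def)
    finally show ?thesis .
  qed
  have "(\<lambda>n. real (Suc n) * (pi * (1 - 1 / (exp (l / real (Suc n)))\<^sup>2))) \<longlonglongrightarrow> 2 * pi * l"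
    by real_asymp
  then have "(\<lambda>n. ennreal (real (Suc n) * (pi * (1 - 1 / (exp (l / real (Suc n)))\<^sup>2)))) \<longlonglongrightarrow> ennreal (2 * pi * l)"
    by (rule tendsto_ennrealI)
  then show ?thesis
    unfolding l_def[symmetric] using le by (intro LIMSEQ_le_const2) auto
qed

text \<open>The coefficient \<open>c\<close> can be computed on the circle through any
  \<open>z\<close> of the annulus, so Cauchy-Schwarz bounds
  \<open>(cmod c)\<^sup>2 / (cmod (z - a))\<^sup>2\<close> by the mean of the square of
  \<open>cmod f\<close> there. Integrating in \<open>z\<close> produces the logarithm with its sharp
  constant.\<close>

lemma residue_coefficient_bound:
  assumes "open \<Omega>" and f: "f \<in> bergman_space \<Omega>" and s: "0 < s" "s < r"
    and A: "{z. s \<le> cmod (z - a) \<and> cmod (z - a) \<le> r} \<subseteq> \<Omega>"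
    and c: "contour_integral (circlepath a s) f = 2 * of_real pi * \<i> * c"
  shows "cmod c \<le> sqrt (l2_sq \<Omega> f / (2 * pi * ln (r / s)))"
proof -
  let ?A = "{z. s \<le> cmod (z - a) \<and> cmod (z - a) \<le> r}"
  have hf: "f holomorphic_on \<Omega>"
    using f by (simp add: bergman_space_def)
  have cf: "continuous_on ?A f"
    using holomorphic_on_imp_continuous_on[OF hf] A by (rule continuous_on_subset)
  have [measurable]: "?A \<in> sets borel"
    by measurable
  have L: "ln (r / s) > 0" using s by simp
  have q: "ennreal ((cmod c)\<^sup>2 * (1 / (cmod (z - a))\<^sup>2)) \<le>
      (\<integral>\<^sup>+x\<in>{0..1}. ennreal ((cmod (f (a + circle_pt x * (z - a))))\<^sup>2) \<partial>lborel)" if z: "z \<in> ?A" for z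
  proof -
    define g where "g x = circle_pt x * f (a + circle_pt x * (z - a))" for x
    have "contour_integral (\<lambda>x. a + circle_pt x * (z - a)) f = contour_integral (circlepath a s) f"
      unfolding circlepath_eq
      by (rule contour_integral_circle_pt_eq[OF assms(1) hf A]) (use z s in auto)
    then have "integral {0..1} (\<lambda>x. (z - a) * g x) = c"
      unfolding c contour_integral_circle_pt by (simp add: g_def mult_ac)
    then have c_eq: "c = (z - a) * integral {0..1} g"
      by simp
    have cg: "continuous_on {0..1} g"
      unfolding g_def
      by (intro continuous_intros continuous_on_compose2[OF cf]) (use z in \<open>auto simp: norm_mult\<close>)
    have "cmod (z - a) > 0" using z s by auto
    then have "(cmod c)\<^sup>2 * (1 / (cmod (z - a))\<^sup>2) = (cmod (integral {0..1} g))\<^sup>2"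
      by (simp add: c_eq norm_mult power_mult_distrib)
    with mean_square_le_nn_integral[OF cg] show ?thesis
      by (simp add: g_def norm_mult)
  qed
  have "ennreal ((cmod c)\<^sup>2 * (2 * pi * ln (r / s))) = ennreal ((cmod c)\<^sup>2) * ennreal (2 * pi * ln (r / s))"
    by (rule ennreal_mult') auto
  also have "\<dots> \<le> ennreal ((cmod c)\<^sup>2) * (\<integral>\<^sup>+z\<in>?A. ennreal (1 / (cmod (z - a))\<^sup>2) \<partial>lborel)"
    by (intro mult_left_mono nn_integral_inverse_square_annulus s) auto
  also have "\<dots> = (\<integral>\<^sup>+z\<in>?A. ennreal ((cmod c)\<^sup>2 * (1 / (cmod (z - a))\<^sup>2)) \<partial>lborel)"
    by (subst nn_integral_cmult[symmetric])
       (simp_all add: ennreal_mult' mult.assoc del: times_divide_eq_right mult_1_right)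
  also have "\<dots> \<le> (\<integral>\<^sup>+z\<in>?A. ennreal ((cmod (f z))\<^sup>2) \<partial>lborel)"
    by (rule nn_integral_le_of_circle_average[where a = a]) (use cf q in \<open>auto simp: norm_mult\<close>)
  also have "\<dots> \<le> (\<integral>\<^sup>+z\<in>\<Omega>. ennreal ((cmod (f z))\<^sup>2) \<partial>lborel)"
    using A by (intro nn_integral_mono) (auto simp: indicator_def)
  also have "\<dots> = ennreal (l2_sq \<Omega> f)"
    by (rule nn_integral_bergman_space[OF f])
  finally have "(cmod c)\<^sup>2 * (2 * pi * ln (r / s)) \<le> l2_sq \<Omega> f"
    by simp
  then show ?thesis
    using L by (intro real_le_rsqrt) (simp add: field_simps)
qed

lemma bergman_norm_le:
  assumes "f \<in> bergman_space \<Omega>" "0 < d" "ball w d \<subseteq> \<Omega>"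
  shows "cmod (f w) \<le> sqrt (l2_sq \<Omega> f) / d"
proof -
  have "d\<^sup>2 * (cmod (f w))\<^sup>2 \<le> pi * (d\<^sup>2 * (cmod (f w))\<^sup>2)"
    using pi_gt3 by (intro mult_right_mono[of 1 pi, simplified]) auto
  also have "\<dots> \<le> l2_sq \<Omega> f"
    using square_norm_le_l2_sq[OF assms] by (simp add: mult.assoc)
  finally have "d * cmod (f w) \<le> sqrt (l2_sq \<Omega> f)"
    by (intro real_le_rsqrt) (simp add: power_mult_distrib)
  then show ?thesis
    using assms by (simp add: field_simps)
qed

text \<open>The non-residual part of the Laurent expansion is written as Cauchy integrals over the circles
  of radii r/2 and 2s, using 1/(z - w) = 1/(z - a) + (w - a)/((z - a)(z - w)) on the inner one.\<close>

lemma laurent_remainder_bound: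
  assumes "open \<Omega>" and f: "f \<in> bergman_space \<Omega>" and s: "0 < s" "4 * s \<le> \<rho>" "\<rho> \<le> r / 4"
    and A: "{z. s \<le> cmod (z - a) \<and> cmod (z - a) \<le> r} \<subseteq> \<Omega>"
    and z: "cmod (z - a) = \<rho>"
    and c: "contour_integral (circlepath a s) f = 2 * of_real pi * \<i> * c"
  shows "cmod ((z - a) * f z - c) \<le> 8 * (\<rho> / r + s / \<rho>) * sqrt (l2_sq \<Omega> f)"
proof -
  define N where "N = sqrt (l2_sq \<Omega> f)"
  have N: "N \<ge> 0" by (simp add: N_def)
  have hf: "f holomorphic_on \<Omega>"
    using f by (simp add: bergman_space_def)
  have cf: "continuous_on \<Omega> f"
    using hf by (rule holomorphic_on_imp_continuous_on)
  have \<rho>: "\<rho> > 0" "r > 0" using s by auto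
  \<comment> \<open>The difference quotient extends holomorphically across \<open>z\<close>, so its
    integrals over the two circles agree; this yields Cauchy's formula for an annulus.\<close>
  define g where "g w = (if w = z then deriv f z else (f w - f z) / (w - z))" for w
  have hg: "g holomorphic_on \<Omega>"
    unfolding g_def using hf assms(1) by (rule pole_lemma_open)
  have ann: "contour_integral (circlepath a t) h = contour_integral (circlepath a t') h"
    if "h holomorphic_on \<Omega>" "s \<le> t" "t \<le> r" "s \<le> t'" "t' \<le> r" for h t t'
    unfolding circlepath_eq
    by (rule contour_integral_circle_pt_eq[OF assms(1) that(1) A]) (use that s in auto)
  have sph: "sphere a t \<subseteq> \<Omega> - {z}" if "s \<le> t" "t \<le> r" "t \<noteq> \<rho>" for t
    using that A z by (auto simp: dist_norm norm_minus_commute)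
  \<comment> \<open>With \<open>4 * s \<le> \<rho>\<close> and \<open>\<rho> \<le> r / 4\<close>
    these circles stay at distance at least \<open>r / 4\<close> and \<open>\<rho> / 2\<close> from
    \<open>z\<close>. Discs of radius \<open>r / 4\<close> and \<open>s\<close> about their points
    stay inside the annulus, so \<open>f\<close> is bounded there by its norm.\<close>
  define t1 t2 where "t1 = r / 2" and "t2 = 2 * s"
  have t: "s \<le> t1" "t1 \<le> r" "t1 \<noteq> \<rho>" "s \<le> t2" "t2 \<le> r" "t2 \<noteq> \<rho>" "0 < t1" "0 < t2" "\<rho> < t1" "t2 < \<rho>"
    using s \<rho> by (auto simp: t1_def t2_def)
  let ?q = "\<lambda>t. contour_integral (circlepath a t)"
  have int: "h contour_integrable_on circlepath a t"
    if "continuous_on (\<Omega> - {z}) h" "s \<le> t" "t \<le> r" "t \<noteq> \<rho>" for h t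
  proof -
    have "path_image (circlepath a t) = sphere a t"
      using that s by (simp add: path_image_circlepath)
    then show ?thesis
      using that sph[OF that(2-)]
      by (intro contour_integrable_continuous_circlepath continuous_on_subset[OF that(1)]) auto
  qed
  have cg: "continuous_on (\<Omega> - {z}) (\<lambda>w. f w / (w - z))"
    using cf by (auto intro!: continuous_intros intro: continuous_on_subset)
  have c1: "continuous_on (\<Omega> - {z}) (\<lambda>w. f z / (w - z))"
    by (auto intro!: continuous_intros)
  have split: "?q t g = ?q t (\<lambda>w. f w / (w - z)) - f z * ?q t (\<lambda>w. 1 / (w - z))"
    if "s \<le> t" "t \<le> r" "t \<noteq> \<rho>" for t
  proof -
    have "?q t g = ?q t (\<lambda>w. f w / (w - z) - f z * (1 / (w - z)))"
      by (rule contour_integral_cong)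
         (use that s sph[OF that] in \<open>auto simp: g_def path_image_circlepath diff_divide_distrib\<close>)
    also have "\<dots> = ?q t (\<lambda>w. f w / (w - z)) - ?q t (\<lambda>w. f z * (1 / (w - z)))"
      using int[OF cg that] int[OF c1 that] by (intro contour_integral_diff) auto
    also have "?q t (\<lambda>w. f z * (1 / (w - z))) = f z * ?q t (\<lambda>w. 1 / (w - z))"
      by (rule contour_integral_lmul) (rule int[OF _ that], auto intro!: continuous_intros)
    finally show ?thesis .
  qed
  have q1: "?q t1 (\<lambda>w. 1 / (w - z)) = 2 * of_real pi * \<i>"
  proof -
    have "((\<lambda>w. 1 / (w - z)) has_contour_integral 2 * of_real pi * \<i> * 1) (circlepath a t1)"
      by (rule Cauchy_integral_circlepath_simple) (use z t in \<open>auto simp: dist_norm norm_minus_commute\<close>)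
    then show ?thesis by (simp add: contour_integral_unique)
  qed
  have q2: "?q t2 (\<lambda>w. 1 / (w - z)) = 0"
  proof -
    have "((\<lambda>w. 1 / (w - z)) has_contour_integral 0) (circlepath a t2)"
      by (rule Cauchy_theorem_disc_simple[of _ a \<rho>])
         (use z t in \<open>auto intro!: holomorphic_intros simp: path_image_circlepath dist_norm norm_minus_commute\<close>)
    then show ?thesis by (rule contour_integral_unique)
  qed
  \<comment> \<open>The outer circle winds once around \<open>z\<close> and the inner one not at
    all, so \<open>f z\<close> survives only in the outer term.\<close>
  have "?q t1 g = ?q t2 g"
    by (rule ann[OF hg]) (use t in auto)
  then have e1: "2 * of_real pi * \<i> * f z = ?q t1 (\<lambda>w. f w / (w - z)) - ?q t2 (\<lambda>w. f w / (w - z))"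
    unfolding split[OF t(1-3)] split[OF t(4-6)] q1 q2 by (simp add: algebra_simps)
  have e2: "(z - a) * ?q t2 (\<lambda>w. f w / (w - z)) = ?q t2 (\<lambda>w. f w * (w - a) / (w - z)) - ?q t2 f"
  proof -
    have ci: "(\<lambda>w. f w * (w - a) / (w - z)) contour_integrable_on circlepath a t2"
      "f contour_integrable_on circlepath a t2"
      using cf by (auto intro!: int t continuous_intros intro: continuous_on_subset)
    have "(z - a) * ?q t2 (\<lambda>w. f w / (w - z)) = ?q t2 (\<lambda>w. (z - a) * (f w / (w - z)))"
      by (rule contour_integral_lmul[symmetric]) (rule int[OF cg t(4-6)])
    also have "\<dots> = ?q t2 (\<lambda>w. f w * (w - a) / (w - z) - f w)"
    proof (rule contour_integral_cong)
      fix w assume "w \<in> path_image (circlepath a t2)"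
      then have "w - z \<noteq> 0"
        using t sph[OF t(4-6)] by (auto simp: path_image_circlepath)
      then show "(z - a) * (f w / (w - z)) = f w * (w - a) / (w - z) - f w"
        by (simp add: divide_simps) (simp add: algebra_simps)
    qed simp
    also have "\<dots> = ?q t2 (\<lambda>w. f w * (w - a) / (w - z)) - ?q t2 f"
      using ci by (rule contour_integral_diff)
    finally show ?thesis .
  qed
  have e3: "?q t2 f = 2 * of_real pi * \<i> * c"
    unfolding c[symmetric] by (rule ann[OF hf]) (use t s in auto)
  have main: "2 * of_real pi * \<i> * ((z - a) * f z - c)
     = (z - a) * ?q t1 (\<lambda>w. f w / (w - z)) - ?q t2 (\<lambda>w. f w * (w - a) / (w - z))"
  proof -
    have "2 * of_real pi * \<i> * ((z - a) * f z - c)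
      = (z - a) * (2 * of_real pi * \<i> * f z) - 2 * of_real pi * \<i> * c"
      by (simp add: algebra_simps)
    also have "\<dots> = (z - a) * ?q t1 (\<lambda>w. f w / (w - z)) - (z - a) * ?q t2 (\<lambda>w. f w / (w - z)) - ?q t2 f"
      unfolding e1 e3[symmetric] by (simp add: algebra_simps)
    finally show ?thesis
      unfolding e2 by simp
  qed
  have fb: "cmod (f w) \<le> N / d" if "0 < d" "s + d \<le> cmod (w - a)" "cmod (w - a) + d \<le> r" for w d
    unfolding N_def
  proof (rule bergman_norm_le[OF f that(1)])
    show "ball w d \<subseteq> \<Omega>"
    proof
      fix y assume "y \<in> ball w d"
      then have "cmod (w - y) < d" by (simp add: dist_norm)
      moreover have "cmod (w - a) \<le> cmod (w - y) + cmod (y - a)" "cmod (y - a) \<le> cmod (w - y) + cmod (w - a)"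
        using norm_triangle_ineq[of "w - y" "y - a"] norm_triangle_ineq[of "y - w" "w - a"]
        by (simp_all add: norm_minus_commute)
      ultimately show "y \<in> \<Omega>"
        using that by (intro subsetD[OF A]) auto
    qed
  qed
  have b1: "cmod (?q t1 (\<lambda>w. f w / (w - z))) \<le> (N / (r / 4)) / (r / 4) * (2 * pi * t1)"
  proof (rule has_contour_integral_bound_circlepath)
    show "((\<lambda>w. f w / (w - z)) has_contour_integral ?q t1 (\<lambda>w. f w / (w - z))) (circlepath a t1)"
      by (rule has_contour_integral_integral) (rule int[OF cg t(1-3)])
    fix w assume w: "cmod (w - a) = t1"
    have "cmod (w - a) \<le> cmod (w - z) + cmod (z - a)"
      using norm_triangle_ineq[of "w - z" "z - a"] by simp
    then have "r / 4 \<le> cmod (w - z)"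
      using w z s by (simp add: t1_def)
    moreover have "cmod (f w) \<le> N / (r / 4)"
      by (rule fb) (use w s \<rho> in \<open>auto simp: t1_def\<close>)
    ultimately show "cmod (f w / (w - z)) \<le> (N / (r / 4)) / (r / 4)"
      unfolding norm_divide using \<rho> N by (intro frac_le) auto
  qed (use t N \<rho> in auto)
  have b2: "cmod (?q t2 (\<lambda>w. f w * (w - a) / (w - z))) \<le> (N / s * t2) / (\<rho> / 2) * (2 * pi * t2)"
  proof (rule has_contour_integral_bound_circlepath)
    have "continuous_on (\<Omega> - {z}) (\<lambda>w. f w * (w - a) / (w - z))"
      using cf by (auto intro!: continuous_intros intro: continuous_on_subset)
    then show "((\<lambda>w. f w * (w - a) / (w - z)) has_contour_integral ?q t2 (\<lambda>w. f w * (w - a) / (w - z))) (circlepath a t2)"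
      using int t by (intro has_contour_integral_integral) auto
    fix w assume w: "cmod (w - a) = t2"
    have "cmod (z - a) \<le> cmod (w - z) + cmod (w - a)"
      using norm_triangle_ineq[of "z - w" "w - a"] by (simp add: norm_minus_commute)
    then have "\<rho> / 2 \<le> cmod (w - z)"
      using w z s by (simp add: t2_def)
    moreover have "cmod (f w) \<le> N / s"
      by (rule fb) (use w s \<rho> in \<open>auto simp: t2_def\<close>)
    ultimately show "cmod (f w * (w - a) / (w - z)) \<le> (N / s * t2) / (\<rho> / 2)"
      unfolding norm_divide norm_mult w using \<rho> N t s by (intro frac_le mult_right_mono) auto
  qed (use t N \<rho> s in auto)
  have "2 * pi * cmod ((z - a) * f z - c) = cmod (2 * of_real pi * \<i> * ((z - a) * f z - c))"
    by (simp add: norm_mult)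
  also have "\<dots> \<le> \<rho> * cmod (?q t1 (\<lambda>w. f w / (w - z))) + cmod (?q t2 (\<lambda>w. f w * (w - a) / (w - z)))"
    unfolding main
    by (rule order_trans[OF norm_triangle_ineq4]) (simp only: norm_mult z order_refl)
  \<comment> \<open>The outer and inner circles contribute \<open>16 * pi * N\<close> times
    \<open>\<rho> / r\<close> and \<open>s / \<rho>\<close> respectively; division by
    \<open>2 * pi\<close> leaves the constant 8.\<close>
  also have "\<dots> \<le> \<rho> * ((N / (r / 4)) / (r / 4) * (2 * pi * t1)) + (N / s * t2) / (\<rho> / 2) * (2 * pi * t2)"
    using b1 b2 \<rho> by (intro add_mono mult_left_mono) auto
  also have "\<dots> = 2 * pi * (8 * (\<rho> / r + s / \<rho>) * N)"
    using \<rho> s by (simp add: t1_def t2_def field_simps power2_eq_square)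
  finally show ?thesis
    by (simp add: N_def)
qed

text \<open>The triangle inequality for residue term plus remainder bounds
  \<open>\<rho> * cmod (f z)\<close> by a multiple of the norm. The residue term keeps its exact
  constant, on which the threshold for \<open>M\<close> depends.\<close>

lemma bergman_kernel_annulus_bound:
  assumes "open \<Omega>" and s: "0 < s" "4 * s \<le> \<rho>" "\<rho> \<le> r / 4"
    and A: "{z. s \<le> cmod (z - a) \<and> cmod (z - a) \<le> r} \<subseteq> \<Omega>"
    and z: "cmod (z - a) = \<rho>"
  shows "bergman_kernel \<Omega> z * \<rho>\<^sup>2 \<le> (1 / sqrt (2 * pi * ln (r / s)) + 8 * (\<rho> / r + s / \<rho>))\<^sup>2"
proof -
  define E where "E = 1 / sqrt (2 * pi * ln (r / s)) + 8 * (\<rho> / r + s / \<rho>)"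
  have \<rho>: "\<rho> > 0" "r > 0" "s < r" using s by auto
  have E: "0 \<le> E" using \<rho> s by (simp add: E_def)
  have z\<Omega>: "z \<in> \<Omega>" using z s \<rho> by (intro subsetD[OF A]) auto
  have "bergman_kernel \<Omega> z \<le> E\<^sup>2 / \<rho>\<^sup>2"
  proof (rule bergman_kernel_le[OF assms(1) z\<Omega>])
    fix f assume f: "f \<in> bergman_space \<Omega>"
    define c where "c = contour_integral (circlepath a s) f / (2 * of_real pi * \<i>)"
    have c: "contour_integral (circlepath a s) f = 2 * of_real pi * \<i> * c"
      by (simp add: c_def)
    have "cmod ((z - a) * f z) \<le> cmod c + cmod ((z - a) * f z - c)"
      using norm_triangle_ineq[of c "(z - a) * f z - c"] by simp
    also have "\<dots> \<le> sqrt (l2_sq \<Omega> f / (2 * pi * ln (r / s))) + 8 * (\<rho> / r + s / \<rho>) * sqrt (l2_sq \<Omega> f)"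
      using residue_coefficient_bound[OF assms(1) f s(1) \<rho>(3) A c]
        laurent_remainder_bound[OF assms(1) f s A z c] by (rule add_mono)
    also have "\<dots> = E * sqrt (l2_sq \<Omega> f)"
      by (simp add: E_def real_sqrt_divide algebra_simps)
    finally have "\<rho> * cmod (f z) \<le> E * sqrt (l2_sq \<Omega> f)"
      by (simp add: norm_mult z)
    then have "(\<rho> * cmod (f z))\<^sup>2 \<le> (E * sqrt (l2_sq \<Omega> f))\<^sup>2"
      using \<rho> by (intro power_mono) auto
    then show "(cmod (f z))\<^sup>2 \<le> E\<^sup>2 / \<rho>\<^sup>2 * l2_sq \<Omega> f"
      using \<rho> by (simp add: power_mult_distrib field_simps)
  qed simp
  then show ?thesis
    using \<rho> by (simp add: E_def field_simps)
qed

section \<open>Annuli missing the boundary\<close>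

lemma boundary_dist_pos:
  assumes "open \<Omega>" "z \<in> \<Omega>" "frontier \<Omega> \<noteq> {}"
  shows "0 < boundary_dist \<Omega> z"
proof -
  have "z \<notin> frontier \<Omega>"
    using assms by (simp add: frontier_def interior_open)
  then show ?thesis
    unfolding boundary_dist_def using assms by (simp add: infdist_pos_not_in_closed)
qed

text \<open>A connected set missing the frontier lies inside \<open>\<Omega>\<close> or outside it.
  Outside is impossible: the connected set \<open>\<Omega>\<close> has points closer to
  \<open>a\<close> than \<open>s\<close>, and also the point \<open>p\<close> at distance at least
  \<open>s\<close> from \<open>a\<close>, so it meets the circle of radius \<open>s\<close>.\<close>

lemma annulus_subset_of_disjoint_frontier:
  assumes "open \<Omega>" "connected \<Omega>" and a: "a \<in> frontier \<Omega>" and p: "p \<in> \<Omega>"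
    and s: "0 < s" "s \<le> r" "s \<le> boundary_dist \<Omega> p"
    and no: "\<not> (\<exists>z\<in>frontier \<Omega>. s \<le> cmod (z - a) \<and> cmod (z - a) \<le> r)"
  shows "{z. s \<le> cmod (z - a) \<and> cmod (z - a) \<le> r} \<subseteq> \<Omega>"
proof (rule ccontr)
  let ?A = "{z. s \<le> cmod (z - a) \<and> cmod (z - a) \<le> r}"
  assume "\<not> ?A \<subseteq> \<Omega>"
  then have "?A - \<Omega> \<noteq> {}" by blast
  moreover have "connected ?A"
    by (intro connected_annulus) auto
  moreover have "?A \<inter> frontier \<Omega> = {}"
    using no by blast
  ultimately have disj: "?A \<inter> \<Omega> = {}"
    using connected_Int_frontier[of ?A \<Omega>] by blast
  have "\<Omega> \<inter> ball a s \<noteq> {}"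
  proof -
    have "a \<in> closure \<Omega>" using a by (simp add: frontier_def)
    then obtain y where "y \<in> \<Omega>" "dist y a < s"
      using s(1) by (meson closure_approachable)
    then show ?thesis by (auto simp: dist_commute)
  qed
  moreover have "p \<in> \<Omega> - ball a s"
    using p s(3) infdist_le[OF a, of p] by (auto simp: boundary_dist_def dist_commute)
  ultimately have "\<Omega> \<inter> frontier (ball a s) \<noteq> {}"
    using connected_Int_frontier[OF assms(2), of "ball a s"] by blast
  moreover have "frontier (ball a s) \<subseteq> ?A"
    using s by (auto simp: dist_norm norm_minus_commute)
  ultimately show False
    using disj by blast
qed

text \<open>The shared core of the three cases, with \<open>\<phi>\<close> the correction factor in
  the lower bound. If the annulus misses the frontier, the kernel bound holds at a point
  \<open>z\<close> at distance \<open>\<rho>\<close> from \<open>a\<close>. The hypothesis applies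
  at the possibly smaller distance \<open>\<delta>\<close> of \<open>z\<close> to the frontier, and
  the condition on \<open>\<phi>\<close> carries it over to \<open>\<rho>\<close>, against
  \<open>small\<close>.\<close>

lemma frontier_meets_annulus:
  assumes "open \<Omega>" "connected \<Omega>" and a: "a \<in> frontier \<Omega>" and p: "p \<in> \<Omega>"
    and lower: "\<And>z. z \<in> \<Omega> \<Longrightarrow> boundary_dist \<Omega> z < \<epsilon> \<Longrightarrow>
        c / ((boundary_dist \<Omega> z)\<^sup>2 * \<phi> (boundary_dist \<Omega> z)) \<le> bergman_kernel \<Omega> z"
    and s: "0 < s" "4 * s \<le> \<rho>" "\<rho> \<le> r / 4" "s \<le> boundary_dist \<Omega> p" "\<rho> < \<epsilon>"
    and \<phi>: "\<And>t. 0 < t \<Longrightarrow> t \<le> \<rho> \<Longrightarrow> 0 < \<phi> t \<and> t\<^sup>2 * \<phi> t \<le> \<rho>\<^sup>2 * \<phi> \<rho>"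
    and small: "(1 / sqrt (2 * pi * ln (r / s)) + 8 * (\<rho> / r + s / \<rho>))\<^sup>2 * \<phi> \<rho> < c"
  shows "\<exists>z\<in>frontier \<Omega>. s \<le> cmod (z - a) \<and> cmod (z - a) \<le> r"
proof (rule ccontr)
  assume no: "\<not> ?thesis"
  let ?E = "(1 / sqrt (2 * pi * ln (r / s)) + 8 * (\<rho> / r + s / \<rho>))\<^sup>2"
  have \<rho>: "0 < \<rho>" "0 < r" "s \<le> r"
    using s by auto
  have A: "{z. s \<le> cmod (z - a) \<and> cmod (z - a) \<le> r} \<subseteq> \<Omega>"
    by (rule annulus_subset_of_disjoint_frontier[OF assms(1-4) s(1) \<rho>(3) s(4) no])
  define z where "z = a + of_real \<rho>"
  have z: "cmod (z - a) = \<rho>"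
    using \<rho> by (simp add: z_def)
  have z\<Omega>: "z \<in> \<Omega>"
    using s \<rho> z by (intro subsetD[OF A]) auto
  define \<delta> where "\<delta> = boundary_dist \<Omega> z"
  have \<delta>: "0 < \<delta>" "\<delta> \<le> \<rho>"
    using boundary_dist_pos[OF assms(1) z\<Omega>] a infdist_le[OF a, of z] z
    by (auto simp: \<delta>_def boundary_dist_def dist_norm)
  have pos: "0 < \<phi> \<rho>" "0 < \<delta>\<^sup>2 * \<phi> \<delta>" and le: "\<delta>\<^sup>2 * \<phi> \<delta> \<le> \<rho>\<^sup>2 * \<phi> \<rho>"
    using \<phi>[of \<rho>] \<phi>[of \<delta>] \<rho> \<delta> by auto
  \<comment> \<open>The sign of \<open>c\<close> is read off from \<open>small\<close>; it makes the
    quotient decrease when the denominator grows.\<close>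
  have "0 \<le> ?E * \<phi> \<rho>" using pos by simp
  then have c: "0 \<le> c" using small by linarith
  have "c / (\<rho>\<^sup>2 * \<phi> \<rho>) \<le> c / (\<delta>\<^sup>2 * \<phi> \<delta>)"
    using le c by (rule divide_left_mono) (use pos \<rho> in simp)
  also have "\<dots> \<le> bergman_kernel \<Omega> z"
    unfolding \<delta>_def by (rule lower[OF z\<Omega>]) (use \<delta> s in \<open>auto simp: \<delta>_def\<close>)
  finally have "c / (\<rho>\<^sup>2 * \<phi> \<rho>) * \<rho>\<^sup>2 \<le> bergman_kernel \<Omega> z * \<rho>\<^sup>2"
    by (rule mult_right_mono) simp
  also have "\<dots> \<le> ?E"
    by (rule bergman_kernel_annulus_bound[OF assms(1) s(1-3) A z])
  finally have "c / \<phi> \<rho> \<le> ?E"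
    using \<rho> by simp
  then show False
    using small pos by (simp add: field_simps)
qed

section \<open>Monotonicity of the comparison functions\<close>

text \<open>With \<open>\<rho> = u * t\<close> the logarithm splits off \<open>ln u\<close>, which
  \<open>2 * ln u \<le> u\<^sup>2 - 1\<close> absorbs. The threshold 1/2 is sharp:
  \<open>t\<^sup>2 * ln (1 / t)\<close> increases exactly until
  \<open>ln (1 / t) = 1 / 2\<close>.\<close>

lemma square_times_ln_mono:
  fixes t \<rho> :: real
  assumes t: "0 < t" "t \<le> \<rho>" and L: "1 / 2 \<le> ln (1 / \<rho>)"
  shows "0 < ln (1 / t)" "t\<^sup>2 * ln (1 / t) \<le> \<rho>\<^sup>2 * ln (1 / \<rho>)"
proof -
  define u where "u = \<rho> / t"
  have u: "1 \<le> u" "\<rho> = u * t" using t by (auto simp: u_def)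
  have e: "ln (1 / t) = ln (1 / \<rho>) + ln u"
    using t by (simp add: u_def ln_div)
  show "0 < ln (1 / t)"
    using L u ln_ge_zero[of u] unfolding e by linarith
  have "2 * ln u \<le> u\<^sup>2 - 1"
    using ln_le_minus_one[of "u\<^sup>2"] u by (simp add: ln_realpow)
  moreover have "1 / 2 * (u\<^sup>2 - 1) \<le> ln (1 / \<rho>) * (u\<^sup>2 - 1)"
    using L u by (intro mult_right_mono) auto
  ultimately have "ln (1 / t) \<le> u\<^sup>2 * ln (1 / \<rho>)"
    unfolding e by (simp add: algebra_simps)
  then have "t\<^sup>2 * ln (1 / t) \<le> t\<^sup>2 * (u\<^sup>2 * ln (1 / \<rho>))"
    by (intro mult_left_mono) auto
  also have "\<dots> = (u * t)\<^sup>2 * ln (1 / \<rho>)"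
    by (simp only: power_mult_distrib mult_ac)
  finally show "t\<^sup>2 * ln (1 / t) \<le> \<rho>\<^sup>2 * ln (1 / \<rho>)"
    unfolding u(2)[symmetric] .
qed

text \<open>Since \<open>ln (1 / \<rho>) \<ge> 1\<close>, the inequality
  \<open>ln (1 + x) \<le> x\<close> shows that the iterated logarithm also grows by at most
  \<open>ln u\<close>; the argument for the single logarithm then carries over.\<close>

lemma square_times_ln_ln_mono:
  fixes t \<rho> :: real
  assumes t: "0 < t" "t \<le> \<rho>" and L: "1 \<le> ln (1 / \<rho>)" and LL: "1 / 2 \<le> ln (ln (1 / \<rho>))"
  shows "0 < ln (ln (1 / t))" "t\<^sup>2 * ln (ln (1 / t)) \<le> \<rho>\<^sup>2 * ln (ln (1 / \<rho>))"
proof -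
  define u where "u = \<rho> / t"
  have u: "1 \<le> u" "\<rho> = u * t" using t by (auto simp: u_def)
  have e: "ln (1 / t) = ln (1 / \<rho>) + ln u"
    using t by (simp add: u_def ln_div)
  have lu: "0 \<le> ln u" using u by simp
  have "ln (ln (1 / \<rho>)) \<le> ln (ln (1 / t))"
    unfolding e using L lu by simp
  then show "0 < ln (ln (1 / t))" using LL by linarith
  have "ln (1 / t) = ln (1 / \<rho>) * (1 + ln u / ln (1 / \<rho>))"
    unfolding e using L by (simp add: field_simps)
  then have "ln (ln (1 / t)) = ln (ln (1 / \<rho>)) + ln (1 + ln u / ln (1 / \<rho>))"
    using L lu by (subst ln_mult_pos[symmetric]) (auto intro!: add_pos_nonneg)
  also have "ln (1 + ln u / ln (1 / \<rho>)) \<le> ln u / ln (1 / \<rho>)"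
    by (rule ln_add_one_self_le_self) (use L lu in auto)
  also have "\<dots> \<le> ln u / 1"
    using L lu by (intro divide_left_mono) auto
  finally have "ln (ln (1 / t)) \<le> ln (ln (1 / \<rho>)) + ln u" by simp
  moreover have "2 * ln u \<le> u\<^sup>2 - 1"
    using ln_le_minus_one[of "u\<^sup>2"] u by (simp add: ln_realpow)
  moreover have "1 / 2 * (u\<^sup>2 - 1) \<le> ln (ln (1 / \<rho>)) * (u\<^sup>2 - 1)"
    using LL u by (intro mult_right_mono) auto
  ultimately have "ln (ln (1 / t)) \<le> u\<^sup>2 * ln (ln (1 / \<rho>))"
    by (simp add: algebra_simps)
  then have "t\<^sup>2 * ln (ln (1 / t)) \<le> t\<^sup>2 * (u\<^sup>2 * ln (ln (1 / \<rho>)))"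
    by (intro mult_left_mono) auto
  also have "\<dots> = (u * t)\<^sup>2 * ln (ln (1 / \<rho>))"
    by (simp only: power_mult_distrib mult_ac)
  finally show "t\<^sup>2 * ln (ln (1 / t)) \<le> \<rho>\<^sup>2 * ln (ln (1 / \<rho>))"
    unfolding u(2)[symmetric] .
qed

section \<open>The three boundary conditions: choice of the radii\<close>

text \<open>Taking \<open>s = C * r\<close> and for \<open>\<rho>\<close> the geometric mean of
  \<open>s\<close> and \<open>r\<close> makes both error ratios equal to \<open>sqrt C\<close>. The
  kernel bound then depends on \<open>C\<close> alone and tends to 0 with it, so one
  \<open>C\<close> serves all scales.\<close>

lemma uniformly_perfect_frontier:
  assumes "open \<Omega>" "connected \<Omega>" and p: "p \<in> \<Omega>" and ne: "frontier \<Omega> \<noteq> {}"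
    and "0 < c" "0 < \<epsilon>"
    and lower: "\<And>z. z \<in> \<Omega> \<Longrightarrow> boundary_dist \<Omega> z < \<epsilon> \<Longrightarrow>
        c / (boundary_dist \<Omega> z)\<^sup>2 \<le> bergman_kernel \<Omega> z"
  shows "uniformly_perfect (frontier \<Omega>)"
proof -
  define D where "D = diameter (frontier \<Omega>)"
  define \<delta> where "\<delta> = boundary_dist \<Omega> p"
  have \<delta>: "0 < \<delta>"
    unfolding \<delta>_def by (rule boundary_dist_pos[OF assms(1) p ne])
  have "((\<lambda>C. (1 / sqrt (2 * pi * ln (1 / C)) + 16 * sqrt C)\<^sup>2) \<longlongrightarrow> 0) (at_right 0)"
    by real_asymp
  then have "\<forall>\<^sub>F C in at_right 0. (1 / sqrt (2 * pi * ln (1 / C)) + 16 * sqrt C)\<^sup>2 < c"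
    using \<open>0 < c\<close> by (rule order_tendstoD)
  \<comment> \<open>The conditions on \<open>s\<close> and \<open>\<rho>\<close> must hold for all
    \<open>r < D\<close> at once, so they are imposed at \<open>D\<close>.\<close>
  moreover have "((\<lambda>C. C * D) \<longlongrightarrow> 0) (at_right 0)" "((\<lambda>C. sqrt C * D) \<longlongrightarrow> 0) (at_right 0)"
    by real_asymp+
  then have "\<forall>\<^sub>F C in at_right 0. C * D < \<delta>" "\<forall>\<^sub>F C in at_right 0. sqrt C * D < \<epsilon>"
    using \<delta> \<open>0 < \<epsilon>\<close> by (auto elim: order_tendstoD)
  \<comment> \<open>The bound 1/16 means \<open>sqrt C < 1 / 4\<close>, which gives both
    \<open>4 * s \<le> \<rho>\<close> and \<open>\<rho> \<le> r / 4\<close>.\<close>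
  moreover have "\<forall>\<^sub>F C::real in at_right 0. 0 < C" "\<forall>\<^sub>F C::real in at_right 0. C < 1 / 16"
    by real_asymp+
  ultimately have "\<forall>\<^sub>F C in at_right 0. (1 / sqrt (2 * pi * ln (1 / C)) + 16 * sqrt C)\<^sup>2 < c
      \<and> C * D < \<delta> \<and> sqrt C * D < \<epsilon> \<and> 0 < C \<and> C < 1 / 16"
    by eventually_elim auto
  then obtain C where C: "(1 / sqrt (2 * pi * ln (1 / C)) + 16 * sqrt C)\<^sup>2 < c"
      "C * D < \<delta>" "sqrt C * D < \<epsilon>" "0 < C" "C < 1 / 16"
    by (auto dest: eventually_happens'[OF trivial_limit_at_right_real])
  define q where "q = sqrt C"
  have q: "0 < q" "q < 1 / 4" "C = q * q"
    using C real_sqrt_less_mono[of C "1 / 16"] by (auto simp: q_def real_sqrt_divide)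
  have "\<exists>z\<in>frontier \<Omega>. C * r \<le> cmod (z - a) \<and> cmod (z - a) \<le> r"
    if a: "a \<in> frontier \<Omega>" and r: "0 < r" "r < D" for a r
  proof (rule frontier_meets_annulus[OF assms(1,2) a p, where \<rho> = "q * r" and \<phi> = "\<lambda>_. 1" and c = c and \<epsilon> = \<epsilon>])
    show "c / ((boundary_dist \<Omega> z)\<^sup>2 * 1) \<le> bergman_kernel \<Omega> z"
      if "z \<in> \<Omega>" "boundary_dist \<Omega> z < \<epsilon>" for z
      using lower[OF that] by simp
    show "4 * (C * r) \<le> q * r" "q * r \<le> r / 4" "0 < C * r"
      using q r by (auto simp: mult_le_cancel_right)
    have "C * r < C * D" "q * r < q * D"
      using r q by auto
    then show "C * r \<le> boundary_dist \<Omega> p" "q * r < \<epsilon>"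
      using C(2,3) unfolding \<delta>_def q_def by linarith+
    have "r / (C * r) = 1 / C" "q * r / r = q" "C * r / (q * r) = q"
      using q r by auto
    then show "(1 / sqrt (2 * pi * ln (r / (C * r))) + 8 * (q * r / r + C * r / (q * r)))\<^sup>2 * 1 < c"
      using C(1) by (simp add: q_def)
    show "0 < (1::real) \<and> t\<^sup>2 * 1 \<le> (q * r)\<^sup>2 * 1" if "0 < t" "t \<le> q * r" for t
      using that by (auto intro: power_mono)
  qed
  then show ?thesis
    unfolding uniformly_perfect_def D_def using C by (intro conjI exI[of _ C]) auto
qed

text \<open>Here \<open>ln (r / s)\<close> is \<open>b * ln (1 / r)\<close>. The radius
  \<open>\<rho> = r / ln (1 / r)\<close> makes both errors of smaller order than the residue term
  while \<open>ln (1 / \<rho>)\<close> stays asymptotic to \<open>ln (1 / r)\<close>. The product in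
  the core lemma thus tends to \<open>1 / (2 * pi * b)\<close>, which is below
  \<open>M\<close>.\<close>

lemma condU1_frontier:
  assumes "open \<Omega>" "connected \<Omega>" and p: "p \<in> \<Omega>" and ne: "frontier \<Omega> \<noteq> {}"
    and "0 < b" "1 / (2 * pi * b) < M" "0 < \<epsilon>"
    and lower: "\<And>z. z \<in> \<Omega> \<Longrightarrow> boundary_dist \<Omega> z < \<epsilon> \<Longrightarrow>
        M / ((boundary_dist \<Omega> z)\<^sup>2 * ln (1 / boundary_dist \<Omega> z)) \<le> bergman_kernel \<Omega> z"
  shows "condU1 (1 + b) (frontier \<Omega>)"
proof -
  define \<delta> where "\<delta> = boundary_dist \<Omega> p"
  have \<delta>: "0 < \<delta>"
    unfolding \<delta>_def by (rule boundary_dist_pos[OF assms(1) p ne])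
  define s where "s r = r powr (1 + b)" for r :: real
  define \<rho> where "\<rho> r = r / ln (1 / r)" for r :: real
  have "((\<lambda>r. (1 / sqrt (2 * pi * (b * ln (1 / r))) + 8 * (1 / ln (1 / r) + r powr b * ln (1 / r)))\<^sup>2
      * ln (1 / (r / ln (1 / r)))) \<longlongrightarrow> 1 / (2 * pi * b)) (at_right 0)"
    using \<open>0 < b\<close> by real_asymp (simp add: powr_half_sqrt inverse_eq_divide power_divide)
  then have "\<forall>\<^sub>F r in at_right 0. (1 / sqrt (2 * pi * (b * ln (1 / r))) + 8 * (1 / ln (1 / r) + r powr b * ln (1 / r)))\<^sup>2
      * ln (1 / \<rho> r) < M"
    unfolding \<rho>_def using assms(6) by (rule order_tendstoD)
  moreover have "((\<lambda>r. r powr (1 + b)) \<longlongrightarrow> 0) (at_right 0)" "((\<lambda>r::real. r / ln (1 / r)) \<longlongrightarrow> 0) (at_right 0)"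
    using \<open>0 < b\<close> by real_asymp+
  then have "\<forall>\<^sub>F r in at_right 0. s r < \<delta>" "\<forall>\<^sub>F r in at_right 0. \<rho> r < \<epsilon>"
    unfolding s_def \<rho>_def using \<delta> \<open>0 < \<epsilon>\<close> by (auto elim: order_tendstoD)
  moreover have "\<forall>\<^sub>F r in at_right 0. 4 * s r \<le> \<rho> r" "\<forall>\<^sub>F r in at_right 0. \<rho> r \<le> r / 4"
    "\<forall>\<^sub>F r in at_right 0. 1 / 2 \<le> ln (1 / \<rho> r)" "\<forall>\<^sub>F r::real in at_right 0. 1 < ln (1 / r)"
    unfolding s_def \<rho>_def using \<open>0 < b\<close> by real_asymp+
  ultimately have "\<forall>\<^sub>F r in at_right 0. (1 / sqrt (2 * pi * (b * ln (1 / r))) + 8 * (1 / ln (1 / r) + r powr b * ln (1 / r)))\<^sup>2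
      * ln (1 / \<rho> r) < M \<and> s r < \<delta> \<and> \<rho> r < \<epsilon> \<and> 4 * s r \<le> \<rho> r \<and> \<rho> r \<le> r / 4
      \<and> 1 / 2 \<le> ln (1 / \<rho> r) \<and> 1 < ln (1 / r)"
    by eventually_elim auto
  then obtain r1 where r1: "0 < r1" and small: "\<And>r. 0 < r \<Longrightarrow> r < r1 \<Longrightarrow>
      (1 / sqrt (2 * pi * (b * ln (1 / r))) + 8 * (1 / ln (1 / r) + r powr b * ln (1 / r)))\<^sup>2
      * ln (1 / \<rho> r) < M \<and> s r < \<delta> \<and> \<rho> r < \<epsilon> \<and> 4 * s r \<le> \<rho> r \<and> \<rho> r \<le> r / 4
      \<and> 1 / 2 \<le> ln (1 / \<rho> r) \<and> 1 < ln (1 / r)"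
    unfolding eventually_at_right_field by auto
  \<comment> \<open>The cap at 1 ensures that \<open>r powr (1 + b)\<close> does not exceed
    \<open>r\<close>.\<close>
  define r0 where "r0 = min r1 1"
  have "\<exists>z\<in>frontier \<Omega>. s r \<le> cmod (z - a) \<and> cmod (z - a) \<le> r"
    if a: "a \<in> frontier \<Omega>" and r: "0 < r" "r < r0" for a r
  proof (rule frontier_meets_annulus[OF assms(1,2) a p, where \<rho> = "\<rho> r" and \<phi> = "\<lambda>t. ln (1 / t)" and c = M and \<epsilon> = \<epsilon>])
    have sm: "(1 / sqrt (2 * pi * (b * ln (1 / r))) + 8 * (1 / ln (1 / r) + r powr b * ln (1 / r)))\<^sup>2
      * ln (1 / \<rho> r) < M" "s r < \<delta>" "\<rho> r < \<epsilon>" "4 * s r \<le> \<rho> r" "\<rho> r \<le> r / 4"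
      "1 / 2 \<le> ln (1 / \<rho> r)" "1 < ln (1 / r)"
      using small[of r] r by (auto simp: r0_def)
    show "M / ((boundary_dist \<Omega> z)\<^sup>2 * ln (1 / boundary_dist \<Omega> z)) \<le> bergman_kernel \<Omega> z"
      if "z \<in> \<Omega>" "boundary_dist \<Omega> z < \<epsilon>" for z
      using lower[OF that] .
    show "0 < s r" using r by (simp add: s_def)
    show "s r \<le> boundary_dist \<Omega> p" "\<rho> r < \<epsilon>" "4 * s r \<le> \<rho> r" "\<rho> r \<le> r / 4"
      using sm by (auto simp: \<delta>_def)
    show "0 < ln (1 / t) \<and> t\<^sup>2 * ln (1 / t) \<le> (\<rho> r)\<^sup>2 * ln (1 / \<rho> r)" if "0 < t" "t \<le> \<rho> r" for t
      using square_times_ln_mono[OF that sm(6)] by simp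
    have sr: "s r = r * r powr b"
      using r by (simp add: s_def powr_add)
    have "ln (r / s r) = b * ln (1 / r)"
      using r by (simp add: sr ln_div ln_powr)
    moreover have "\<rho> r / r = 1 / ln (1 / r)" "s r / \<rho> r = r powr b * ln (1 / r)"
      using r by (simp_all add: \<rho>_def sr)
    ultimately show "(1 / sqrt (2 * pi * ln (r / s r)) + 8 * (\<rho> r / r + s r / \<rho> r))\<^sup>2 * ln (1 / \<rho> r) < M"
      using sm(1) by simp
  qed
  moreover have "mono_on {0..<r0} s"
    using \<open>0 < b\<close> by (auto intro!: mono_onI powr_mono2 simp: s_def)
  moreover have "s r \<le> r" if "r \<in> {0..<r0}" for r
    using powr_mono'[of 1 "1 + b" r] that \<open>0 < b\<close> by (auto simp: s_def r0_def)
  ultimately have "h_uniformly_perfect (\<lambda>r. 1 * h1 (1 + b) r) r0 (frontier \<Omega>)"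
    using r1 unfolding h_uniformly_perfect_def h1_def s_def by (auto simp: r0_def)
  then show ?thesis
    unfolding condU1_def using r1 by (intro exI[of _ 1] exI[of _ r0]) (auto simp: r0_def)
qed

text \<open>The same scheme one logarithm deeper: \<open>ln (r / s)\<close> is
  \<open>\<beta> * ln (- ln r)\<close>, and dividing \<open>r\<close> by \<open>ln (- ln r)\<close>
  gives a \<open>\<rho>\<close> whose errors are negligible, so the limit is
  \<open>1 / (2 * pi * \<beta>)\<close>.\<close>

lemma condU2_frontier:
  assumes "open \<Omega>" "connected \<Omega>" and p: "p \<in> \<Omega>" and ne: "frontier \<Omega> \<noteq> {}"
    and "0 < \<beta>" "1 / (2 * pi * \<beta>) < c" "0 < \<epsilon>"
    and lower: "\<And>z. z \<in> \<Omega> \<Longrightarrow> boundary_dist \<Omega> z < \<epsilon> \<Longrightarrow>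
        c / ((boundary_dist \<Omega> z)\<^sup>2 * ln (ln (1 / boundary_dist \<Omega> z))) \<le> bergman_kernel \<Omega> z"
  shows "condU2 \<beta> (frontier \<Omega>)"
proof -
  define \<delta> where "\<delta> = boundary_dist \<Omega> p"
  have \<delta>: "0 < \<delta>"
    unfolding \<delta>_def by (rule boundary_dist_pos[OF assms(1) p ne])
  define s where "s r = r * (- ln r) powr (- \<beta>)" for r :: real
  define \<rho> where "\<rho> r = r / ln (- ln r)" for r :: real
  have "((\<lambda>r. (1 / sqrt (2 * pi * (\<beta> * ln (- ln r)))
        + 8 * (1 / ln (- ln r) + (- ln r) powr (- \<beta>) * ln (- ln r)))\<^sup>2
      * ln (ln (1 / (r / ln (- ln r))))) \<longlongrightarrow> 1 / (2 * pi * \<beta>)) (at_right 0)"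
    using \<open>0 < \<beta>\<close> by real_asymp (simp add: powr_half_sqrt inverse_eq_divide power_divide)
  then have "\<forall>\<^sub>F r in at_right 0. (1 / sqrt (2 * pi * (\<beta> * ln (- ln r)))
        + 8 * (1 / ln (- ln r) + (- ln r) powr (- \<beta>) * ln (- ln r)))\<^sup>2
      * ln (ln (1 / \<rho> r)) < c"
    unfolding \<rho>_def using assms(6) by (rule order_tendstoD)
  moreover have "((\<lambda>r. r * (- ln r) powr (- \<beta>)) \<longlongrightarrow> 0) (at_right 0)" "((\<lambda>r::real. r / ln (- ln r)) \<longlongrightarrow> 0) (at_right 0)"
    using \<open>0 < \<beta>\<close> by real_asymp+
  then have "\<forall>\<^sub>F r in at_right 0. s r < \<delta>" "\<forall>\<^sub>F r in at_right 0. \<rho> r < \<epsilon>"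
    unfolding s_def \<rho>_def using \<delta> \<open>0 < \<epsilon>\<close> by (auto elim: order_tendstoD)
  moreover have "\<forall>\<^sub>F r in at_right 0. 4 * s r \<le> \<rho> r" "\<forall>\<^sub>F r in at_right 0. \<rho> r \<le> r / 4"
    "\<forall>\<^sub>F r in at_right 0. 1 \<le> ln (1 / \<rho> r)" "\<forall>\<^sub>F r in at_right 0. 1 / 2 \<le> ln (ln (1 / \<rho> r))"
    "\<forall>\<^sub>F r::real in at_right 0. 0 < ln (- ln r)"
    unfolding s_def \<rho>_def using \<open>0 < \<beta>\<close> by real_asymp+
  ultimately have "\<forall>\<^sub>F r in at_right 0. (1 / sqrt (2 * pi * (\<beta> * ln (- ln r)))
        + 8 * (1 / ln (- ln r) + (- ln r) powr (- \<beta>) * ln (- ln r)))\<^sup>2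
      * ln (ln (1 / \<rho> r)) < c \<and> s r < \<delta> \<and> \<rho> r < \<epsilon> \<and> 4 * s r \<le> \<rho> r \<and> \<rho> r \<le> r / 4
      \<and> 1 \<le> ln (1 / \<rho> r) \<and> 1 / 2 \<le> ln (ln (1 / \<rho> r)) \<and> 0 < ln (- ln r)"
    by eventually_elim auto
  then obtain r1 where r1: "0 < r1" and small: "\<And>r. 0 < r \<Longrightarrow> r < r1 \<Longrightarrow>
      (1 / sqrt (2 * pi * (\<beta> * ln (- ln r)))
        + 8 * (1 / ln (- ln r) + (- ln r) powr (- \<beta>) * ln (- ln r)))\<^sup>2
      * ln (ln (1 / \<rho> r)) < c \<and> s r < \<delta> \<and> \<rho> r < \<epsilon> \<and> 4 * s r \<le> \<rho> r \<and> \<rho> r \<le> r / 4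
      \<and> 1 \<le> ln (1 / \<rho> r) \<and> 1 / 2 \<le> ln (ln (1 / \<rho> r)) \<and> 0 < ln (- ln r)"
    unfolding eventually_at_right_field by auto
  \<comment> \<open>The cap at \<open>exp (- 1)\<close> keeps \<open>- ln r\<close> above 1, so its
    negative power is at most 1 (hence \<open>s r \<le> r\<close>) and is monotone in
    \<open>r\<close>.\<close>
  define r0 where "r0 = min r1 (exp (- 1))"
  have ln1: "1 < - ln r" if "0 < r" "r < r0" for r
  proof -
    have "ln r < ln (exp (- 1))"
      using that by (subst ln_less_cancel_iff) (auto simp: r0_def)
    then show ?thesis by simp
  qed
  have "\<exists>z\<in>frontier \<Omega>. s r \<le> cmod (z - a) \<and> cmod (z - a) \<le> r"
    if a: "a \<in> frontier \<Omega>" and r: "0 < r" "r < r0" for a r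
  proof (rule frontier_meets_annulus[OF assms(1,2) a p, where \<rho> = "\<rho> r" and \<phi> = "\<lambda>t. ln (ln (1 / t))" and c = c and \<epsilon> = \<epsilon>])
    have sm: "(1 / sqrt (2 * pi * (\<beta> * ln (- ln r)))
        + 8 * (1 / ln (- ln r) + (- ln r) powr (- \<beta>) * ln (- ln r)))\<^sup>2
      * ln (ln (1 / \<rho> r)) < c" "s r < \<delta>" "\<rho> r < \<epsilon>" "4 * s r \<le> \<rho> r" "\<rho> r \<le> r / 4"
      "1 \<le> ln (1 / \<rho> r)" "1 / 2 \<le> ln (ln (1 / \<rho> r))" "0 < ln (- ln r)"
      using small[of r] r by (auto simp: r0_def)
    show "c / ((boundary_dist \<Omega> z)\<^sup>2 * ln (ln (1 / boundary_dist \<Omega> z))) \<le> bergman_kernel \<Omega> z"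
      if "z \<in> \<Omega>" "boundary_dist \<Omega> z < \<epsilon>" for z
      using lower[OF that] .
    have "0 < (- ln r) powr (- \<beta>)"
      unfolding powr_gt_zero using ln1[OF r] by linarith
    then show "0 < s r" using r by (simp add: s_def)
    show "s r \<le> boundary_dist \<Omega> p" "\<rho> r < \<epsilon>" "4 * s r \<le> \<rho> r" "\<rho> r \<le> r / 4"
      using sm by (auto simp: \<delta>_def)
    show "0 < ln (ln (1 / t)) \<and> t\<^sup>2 * ln (ln (1 / t)) \<le> (\<rho> r)\<^sup>2 * ln (ln (1 / \<rho> r))"
      if "0 < t" "t \<le> \<rho> r" for t
      using square_times_ln_ln_mono[OF that sm(6,7)] by simp
    have "r / s r = (- ln r) powr \<beta>"
      using r by (simp add: s_def powr_minus field_simps)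
    then have "ln (r / s r) = \<beta> * ln (- ln r)"
      using ln1[OF r] by (simp add: ln_powr)
    moreover have "\<rho> r / r = 1 / ln (- ln r)" "s r / \<rho> r = (- ln r) powr (- \<beta>) * ln (- ln r)"
      using r by (simp_all add: \<rho>_def s_def)
    ultimately show "(1 / sqrt (2 * pi * ln (r / s r)) + 8 * (\<rho> r / r + s r / \<rho> r))\<^sup>2 * ln (ln (1 / \<rho> r)) < c"
      using sm(1) by simp
  qed
  moreover have "mono_on {0..<r0} s"
  proof (rule mono_onI)
    fix x y assume xy: "x \<in> {0..<r0}" "y \<in> {0..<r0}" "x \<le> y"
    show "s x \<le> s y"
    \<comment> \<open>At 0 the logarithm carries no information; the factor \<open>x\<close> alone
      gives \<open>s 0 = 0\<close>.\<close>
    proof (cases "x = 0")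
      case False
      then have "1 < - ln y" "- ln y \<le> - ln x"
        using xy ln1[of y] by auto
      then have "0 < - ln y" "- ln y \<le> - ln x"
        by linarith+
      then have "(- ln x) powr (- \<beta>) \<le> (- ln y) powr (- \<beta>)"
        by (rule powr_mono2'[rotated]) (use \<open>0 < \<beta>\<close> in simp)
      then show ?thesis
        unfolding s_def using xy by (intro mult_mono) auto
    qed (use xy in \<open>simp add: s_def\<close>)
  qed
  moreover have "s r \<le> r" if "r \<in> {0..<r0}" for r
  proof (cases "r = 0")
    case False
    then have "(- ln r) powr (- \<beta>) \<le> 1 powr (- \<beta>)"
      by (intro powr_mono2') (use that ln1[of r] \<open>0 < \<beta>\<close> in auto)
    then have "r * (- ln r) powr (- \<beta>) \<le> r * 1"
      using that by (intro mult_left_mono) auto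
    then show ?thesis by (simp add: s_def)
  qed (simp add: s_def)
  ultimately have "h_uniformly_perfect (\<lambda>r. 1 * h2 \<beta> r) r0 (frontier \<Omega>)"
    using r1 unfolding h_uniformly_perfect_def h2_def s_def by (auto simp: r0_def)
  then show ?thesis
    unfolding condU2_def using r1 by (intro exI[of _ 1] exI[of _ r0]) (auto simp: r0_def)
qed

theorem theorem1p1:
  fixes \<Omega> :: "complex set"
  assumes "open \<Omega>" and "connected \<Omega>" and "\<Omega> \<noteq> {}" and "\<Omega> \<noteq> UNIV"
  shows
   "(bounded \<Omega> \<and>
     (\<exists>c>0. \<exists>\<epsilon>>0. \<forall>z\<in>\<Omega>. boundary_dist \<Omega> z < \<epsilon> \<longrightarrow>
        bergman_kernel \<Omega> z \<ge> c / (boundary_dist \<Omega> z)\<^sup>2)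
      \<longrightarrow> uniformly_perfect (frontier \<Omega>))
    \<and>
    (\<forall>M>0. (\<exists>\<epsilon>>0. \<forall>z\<in>\<Omega>. boundary_dist \<Omega> z < \<epsilon> \<longrightarrow>
        bergman_kernel \<Omega> z \<ge> M / ((boundary_dist \<Omega> z)\<^sup>2 * ln (1 / boundary_dist \<Omega> z)))
      \<longrightarrow> (\<exists>\<alpha>>1. condU1 \<alpha> (frontier \<Omega>))
         \<and> (M > 1 / (2 * pi) \<longrightarrow> (\<exists>\<alpha>. 1 < \<alpha> \<and> \<alpha> < 2 \<and> condU1 \<alpha> (frontier \<Omega>))))
    \<and>
    (\<forall>c>0. (\<exists>\<epsilon>>0. \<forall>z\<in>\<Omega>. boundary_dist \<Omega> z < \<epsilon> \<longrightarrow>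
        bergman_kernel \<Omega> z \<ge> c / ((boundary_dist \<Omega> z)\<^sup>2 * ln (ln (1 / boundary_dist \<Omega> z))))
      \<longrightarrow> (\<exists>\<beta>>0. condU2 \<beta> (frontier \<Omega>)))"
proof -
  obtain p where p: "p \<in> \<Omega>" using assms(3) by blast
  have ne: "frontier \<Omega> \<noteq> {}"
    using assms(3,4) by (simp add: frontier_eq_empty)
  show ?thesis
  proof (intro conjI allI impI)
    assume "bounded \<Omega> \<and> (\<exists>c>0. \<exists>\<epsilon>>0. \<forall>z\<in>\<Omega>. boundary_dist \<Omega> z < \<epsilon> \<longrightarrow>
        bergman_kernel \<Omega> z \<ge> c / (boundary_dist \<Omega> z)\<^sup>2)"
    then show "uniformly_perfect (frontier \<Omega>)"
      using uniformly_perfect_frontier[OF assms(1,2) p ne] by blast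
  next
    fix M :: real
    assume M: "0 < M" and "\<exists>\<epsilon>>0. \<forall>z\<in>\<Omega>. boundary_dist \<Omega> z < \<epsilon> \<longrightarrow>
        bergman_kernel \<Omega> z \<ge> M / ((boundary_dist \<Omega> z)\<^sup>2 * ln (1 / boundary_dist \<Omega> z))"
    then have U1: "condU1 (1 + b) (frontier \<Omega>)" if "0 < b" "1 / (2 * pi * b) < M" for b
      using condU1_frontier[OF assms(1,2) p ne that] by blast
    \<comment> \<open>With \<open>b = 1 / (pi * M)\<close> the limit constant
      \<open>1 / (2 * pi * b)\<close> is \<open>M / 2\<close>.\<close>
    show "\<exists>\<alpha>>1. condU1 \<alpha> (frontier \<Omega>)"
      using M by (intro exI[of _ "1 + 1 / (pi * M)"] conjI U1) (auto simp: field_simps)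
    assume M1: "1 / (2 * pi) < M"
    \<comment> \<open>Admissible exponents need \<open>b\<close> above
      \<open>1 / (2 * pi * M)\<close>, and \<open>\<alpha> < 2\<close> needs \<open>b\<close> below
      1; the assumption on \<open>M\<close> says precisely that there is room between the
      two.\<close>
    then have "1 / (2 * pi * M) < 1"
      using M by (simp add: field_simps)
    then obtain b where b: "1 / (2 * pi * M) < b" "b < 1"
      using dense by blast
    have "0 < 1 / (2 * pi * M)" using M by simp
    then have "0 < b" using b by linarith
    moreover have "1 / (2 * pi * b) < M"
      using b M \<open>0 < b\<close> by (simp add: field_simps)
    ultimately show "\<exists>\<alpha>. 1 < \<alpha> \<and> \<alpha> < 2 \<and> condU1 \<alpha> (frontier \<Omega>)"
      using b by (intro exI[of _ "1 + b"] conjI U1) auto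
  next
    fix c :: real
    assume c: "0 < c" and "\<exists>\<epsilon>>0. \<forall>z\<in>\<Omega>. boundary_dist \<Omega> z < \<epsilon> \<longrightarrow>
        bergman_kernel \<Omega> z \<ge> c / ((boundary_dist \<Omega> z)\<^sup>2 * ln (ln (1 / boundary_dist \<Omega> z)))"
    then have U2: "condU2 \<beta> (frontier \<Omega>)" if "0 < \<beta>" "1 / (2 * pi * \<beta>) < c" for \<beta>
      using condU2_frontier[OF assms(1,2) p ne that] by blast
    \<comment> \<open>With this \<open>\<beta>\<close> the limit constant is
      \<open>c / 2\<close>.\<close>
    show "\<exists>\<beta>>0. condU2 \<beta> (frontier \<Omega>)"
      using c by (intro exI[of _ "1 / (pi * c)"] conjI U2) (auto simp: field_simps)
  qed
qed

end
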